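(* Let $(d_N)_{N\in\mathbb N}$ and $(n_N)_{N\in\mathbb N}$ be diverging sequences of positive integers with $n_N\le 2^{d_N}$, let $(G_N)_{N\in\mathbb N}$ be any sequence of groups with $|G_N|=n_N$, and let $(k_N)_{N\in\mathbb N}$ be positive integers. Write $d,n,G,k$ for $d_N,n_N,G_N,k_N$ and $H:=\mathbb Z_2^d$. If $\liminf_N(k-\log_2n)/k>0$ and $\log k/\log n\to0$, then $$\mathrm{diam}\,G_k\le\mathrm{diam}\,H_k\quad\text{up to smaller order terms with high probability},$$ where $G_k$ and $H_k$ are the random Cayley graphs (both directed or both undirected) of $G$ and $H$, each with respect to $k$ independent uniformly random generators.
   Context: For two random sequences $(\alpha_N)$ and $(\beta_N)$ of reals (allowing the value $\infty$), "$\alpha\le\beta$ with high probability up to smaller order terms" means that there exist non-random real sequences $(\gamma_N)$ and $(\delta_N)$ with $\delta_N\to0$ such that $\mathbb P(\alpha_N\le(1+\delta_N)\gamma_N)\to1$ and $\mathbb P((1-\delta_N)\gamma_N\le\beta_N)\to1$ as $N\to\infty$. For a finite group $G$ and a multiset $z=[z_1,\dots,z_k]$ of elements of $G$, the directed Cayley graph $G^+(z)$ has vertex set $G$ and edge multiset $[(g,gz_i): g\in G, i\le k]$; the undirected Cayley graph $G^-(z)$ has edge multiset $[\{g,gz_i\}: g\in G,i\le k]$. $G_k$ denotes either of $G^\pm(Z)$ with $Z=[Z_1,\dots,Z_k]$, where $Z_1,\dots,Z_k$ are independent and uniform on $G$. $\mathrm{diam}$ is the maximal graph distance between (ordered) pairs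 of vertices (along directed paths if directed; $\infty$ if some vertex cannot be reached from another). *)

theory Defs
  imports "HOL-Probability.Probability" "HOL-Algebra.Product_Groups"
    "Graph_Theory.Shortest_Path"
begin

text \<open>
  Both random sequences may take the value \<open>\<infinity>\<close>. The relation depends on the two sequences of laws
  only, so they need not live on a common probability space. The bounds \<open>\<gamma>\<close> and \<open>\<delta>\<close> are
  deterministic.
\<close>

definition le_up_to_smaller_order_whp ::
  "(nat \<Rightarrow> 'a pmf) \<Rightarrow> (nat \<Rightarrow> 'a \<Rightarrow> ereal) \<Rightarrow> (nat \<Rightarrow> 'b pmf) \<Rightarrow> (nat \<Rightarrow> 'b \<Rightarrow> ereal) \<Rightarrow> bool" where
  "le_up_to_smaller_order_whp p \<alpha> q \<beta> \<longleftrightarrow>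
     (\<exists>\<gamma> \<delta> :: nat \<Rightarrow> real. \<delta> \<longlonglongrightarrow> 0 \<and>
        (\<lambda>N. measure_pmf.prob (p N) {x. \<alpha> N x \<le> ereal ((1 + \<delta> N) * \<gamma> N)}) \<longlonglongrightarrow> 1 \<and>
        (\<lambda>N. measure_pmf.prob (q N) {y. ereal ((1 - \<delta> N) * \<gamma> N) \<le> \<beta> N y}) \<longlonglongrightarrow> 1)"

text \<open>
  A multiset of generators is given as a list; the position \<open>i\<close> in an arc \<open>(g, i)\<close> keeps track of
  multiplicities.
\<close>

definition directed_cayley_graph ::
  "('a, 'b) monoid_scheme \<Rightarrow> 'a list \<Rightarrow> ('a, 'a \<times> nat) pre_digraph" where
  "directed_cayley_graph G zs =
     \<lparr>verts = carrier G,
      arcs = carrier G \<times> {..<length zs},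
      tail = (\<lambda>(g, i). g),
      head = (\<lambda>(g, i). g \<otimes>\<^bsub>G\<^esub> zs ! i)\<rparr>"

text \<open>
  Undirected graphs are represented as symmetric digraphs: the undirected edge \<open>{g, g z\<^sub>i}\<close> becomes
  the two opposite arcs \<open>((g, i), False)\<close> from \<open>g\<close> to \<open>g z\<^sub>i\<close> and \<open>((g, i), True)\<close> back.
\<close>

definition undirected_cayley_graph ::
  "('a, 'b) monoid_scheme \<Rightarrow> 'a list \<Rightarrow> ('a, ('a \<times> nat) \<times> bool) pre_digraph" where
  "undirected_cayley_graph G zs =
     \<lparr>verts = carrier G,
      arcs = (carrier G \<times> {..<length zs}) \<times> UNIV,
      tail = (\<lambda>((g, i), reversed). if reversed then g \<otimes>\<^bsub>G\<^esub> zs ! i else g),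
      head = (\<lambda>((g, i), reversed). if reversed then g else g \<otimes>\<^bsub>G\<^esub> zs ! i)\<rparr>"

lemma wf_digraph_directed_cayley_graph:
  assumes "group G" "set zs \<subseteq> carrier G"
  shows "wf_digraph (directed_cayley_graph G zs)"
proof -
  interpret group G by fact
  show ?thesis
    using assms(2) by unfold_locales (auto simp: directed_cayley_graph_def subset_iff)
qed

lemma sym_digraph_undirected_cayley_graph:
  assumes "group G" "set zs \<subseteq> carrier G"
  shows "sym_digraph (undirected_cayley_graph G zs)"
proof -
  interpret group G by fact
  show ?thesis
    using assms(2)
    by unfold_locales (auto simp: undirected_cayley_graph_def symmetric_conv subset_iff)
qed

text \<open>
  With unit weights, \<open>\<mu>\<close> is the graph distance along directed walks; it is \<open>\<infinity>\<close> if there is no walk.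
\<close>

definition diam :: "('a, 'b) pre_digraph \<Rightarrow> ereal" where
  "diam D = (SUP u\<in>verts D. SUP v\<in>verts D. wf_digraph.\<mu> D (\<lambda>_. 1) u v)"

definition Z2_power :: "nat \<Rightarrow> (nat \<Rightarrow> int) monoid" where
  "Z2_power d = product_group {..<d} (\<lambda>_. integer_mod_group 2)"

definition uniform_generators :: "('a, 'b) monoid_scheme \<Rightarrow> nat \<Rightarrow> 'a list pmf" where
  "uniform_generators G k = replicate_pmf k (pmf_of_set (carrier G))"

end

theory Submission
  imports Defs "HOL-Algebra.FiniteProduct" "HOL-Real_Asymp.Real_Asymp"
begin

text \<open>
  Let \<open>D\<close> be the least radius at which the Hamming ball in the \<open>k\<close>-cube has at least \<open>n\<close> points.
  In \<open>Z\<^sub>2\<^sup>d\<close> a walk of length \<open>r\<close> ends at the sum of a set of at most \<open>r\<close> generators, so for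
  cardinality reasons the diameter is always at least \<open>D\<close>.

  In an arbitrary group of order \<open>n\<close>, the products of \<open>Z\<^sub>1, \<dots>, Z\<^sub>i\<close> over two different index sets
  agree with probability exactly \<open>1/n\<close>: some \<open>Z\<^sub>j\<close> occurs in only one of them. By the second moment
  method the products over the index sets of size at most \<open>L\<close> therefore miss only a small fraction
  \<open>\<epsilon>\<close> of the group as soon as there are many more than \<open>n\<close> such sets, and multiplying by one of the
  remaining generators \<open>Z\<^sub>i\<^sub>+\<^sub>1, \<dots>, Z\<^sub>k\<close> reaches everything except with probability at most
  \<open>n \<epsilon>\<^sup>k\<^sup>-\<^sup>i\<close>. Because \<open>log\<^sub>2 n \<le> (1 - c) k\<close>, the radius \<open>D\<close> stays below \<open>(1/2 - c/8) k\<close>, where the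
  volume of balls grows exponentially with the radius. Hence \<open>L = (1 + o(1)) D\<close> is large enough, even
  with a small proportion of the generators set aside. Finally \<open>D \<rightarrow> \<infinity>\<close> because \<open>ln k = o(ln n)\<close>,
  which absorbs the additional step.
\<close>


section \<open>Volumes of Hamming balls\<close>

definition binomial_ball :: "nat \<Rightarrow> nat \<Rightarrow> nat" where
  "binomial_ball k r = (\<Sum>i\<le>r. k choose i)"

lemma nat_floor_le: "0 \<le> x \<Longrightarrow> real (nat \<lfloor>x\<rfloor>) \<le> x"
  and nat_floor_ge: "x - 1 \<le> real (nat \<lfloor>x\<rfloor>)"
  by linarith+

lemma Suc_times_choose_Suc: "Suc j * (k choose Suc j) = (k - j) * (k choose j)"
  by (metis binomial_absorb_comp binomial_absorption)

lemma two_power_le_central_binomial: "2 ^ k \<le> Suc k * (k choose (k div 2))"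
proof -
  have "(2::nat) ^ k = (\<Sum>i\<le>k. k choose i)" by (rule choose_row_sum[symmetric])
  also have "\<dots> \<le> (\<Sum>i\<le>k. k choose (k div 2))" by (rule sum_mono) (rule binomial_maximum)
  finally show ?thesis by simp
qed

text \<open>Going down from \<open>Suc j\<close> to \<open>j\<close> divides the coefficient by
  \<open>(k - j) / Suc j\<close>, which is at most 3 as long as \<open>4 * Suc j\<close> exceeds
  \<open>k\<close>; the bound on \<open>s\<close> keeps the descent in this range.\<close>

lemma central_binomial_le_three_power:
  "4 * s \<le> k \<Longrightarrow> k choose (k div 2) \<le> 3 ^ s * (k choose (k div 2 - s))"
proof (induction s)
  case (Suc s)
  define j where "j = k div 2 - Suc s"
  have j: "Suc j = k div 2 - s" "k - j \<le> 3 * Suc j" using Suc.prems by (auto simp: j_def)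
  have "Suc j * (k choose Suc j) \<le> 3 * Suc j * (k choose j)"
    unfolding Suc_times_choose_Suc using j(2) by (rule mult_right_mono) simp
  then have "k choose Suc j \<le> 3 * (k choose j)" by (simp only: mult.assoc mult.left_commute[of 3] mult_le_cancel1)
  moreover have "k choose (k div 2) \<le> 3 ^ s * (k choose Suc j)"
    using Suc j by simp
  ultimately have "k choose (k div 2) \<le> 3 ^ s * (3 * (k choose j))"
    by (meson le_trans mult_le_mono2)
  then show ?case by (simp add: j_def)
qed simp

text \<open>Crude, but since \<open>ln k\<close> is of smaller order than \<open>ln n\<close> it
  suffices to force the covering radius to infinity. Layer \<open>Suc r\<close> adds at most
  \<open>k * Suc k ^ r\<close>.\<close>

lemma binomial_ball_le_power: "binomial_ball k r \<le> Suc k ^ r"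
proof (induction r)
  case 0
  then show ?case by (simp add: binomial_ball_def)
next
  case (Suc r)
  have "k choose Suc r \<le> k ^ Suc r"
    by (cases "Suc r \<le> k") (simp_all add: binomial_le_pow binomial_eq_0 del: power_Suc)
  also have "\<dots> \<le> k * Suc k ^ r" by (simp add: power_mono)
  finally show ?case using Suc by (simp add: binomial_ball_def)
qed

text \<open>Consecutive layers have ratio \<open>(k - j) / Suc j\<close>, at least
  \<open>\<rho>\<close> by hypothesis. Hence layer \<open>i + t\<close> dominates layer
  \<open>i\<close> with \<open>t\<close> factors gained, and the shifted layers are distinct layers
  of the larger ball.\<close>

lemma binomial_ball_shift:
  fixes \<rho> :: real
  assumes \<rho>: "\<rho> \<ge> 0" and step: "\<And>j. j < r + t \<Longrightarrow> \<rho> * real (Suc j) \<le> real (k - j)"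
  shows "\<rho> ^ t * binomial_ball k r \<le> binomial_ball k (r + t)"
proof -
  have choose: "\<rho> ^ s * (k choose i) \<le> k choose (i + s)" if "i \<le> r" "s \<le> t" for i s
    using that(2)
  proof (induction s)
    case (Suc s)
    then have "\<rho> ^ Suc s * (k choose i) \<le> \<rho> * (k choose (i + s))"
      using \<rho> by (simp add: mult.assoc mult_left_mono)
    also have "\<rho> * (k choose (i + s)) \<le> k choose (i + Suc s)"
    proof -
      have "\<rho> * (k choose (i + s)) * Suc (i + s) \<le> real (k - (i + s)) * (k choose (i + s))"
        using mult_right_mono[OF step[of "i + s"], of "real (k choose (i + s))"] that Suc.prems
        by (simp add: mult_ac)
      also have "\<dots> = real (k choose (i + Suc s)) * Suc (i + s)"
        by (metis Suc_times_choose_Suc add_Suc_right mult.commute of_nat_mult)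
      finally show ?thesis by (simp only: mult_le_cancel_right_pos of_nat_0_less_iff zero_less_Suc)
    qed
    finally show ?case .
  qed simp
  have "\<rho> ^ t * binomial_ball k r = (\<Sum>i\<le>r. \<rho> ^ t * (k choose i))"
    by (simp add: binomial_ball_def sum_distrib_left)
  also have "\<dots> \<le> (\<Sum>i\<le>r. real (k choose (i + t)))"
    by (rule sum_mono) (use choose in auto)
  also have "\<dots> = (\<Sum>i\<in>(\<lambda>i. i + t) ` {..r}. real (k choose i))"
    by (subst sum.reindex) (auto simp: o_def)
  also have "\<dots> \<le> (\<Sum>i\<le>r + t. real (k choose i))"
    by (rule sum_mono2) auto
  finally show ?thesis by (simp add: binomial_ball_def)
qed

text \<open>Layer \<open>Suc i\<close> arises from layer \<open>i\<close> through a factor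
  \<open>k - i\<close> in one cube and \<open>k' - i\<close> in the other, so each of at most
  \<open>r\<close> steps costs at most one factor \<open>\<theta>\<close>.\<close>

lemma binomial_ball_fewer:
  fixes \<theta> :: real
  assumes \<theta>: "0 \<le> \<theta>" "\<theta> \<le> 1" and step: "\<And>j. j < r \<Longrightarrow> \<theta> * real (k - j) \<le> real (k' - j)"
  shows "\<theta> ^ r * binomial_ball k r \<le> binomial_ball k' r"
proof -
  have choose: "\<theta> ^ i * (k choose i) \<le> k' choose i" if "i \<le> r" for i
    using that
  proof (induction i)
    case (Suc i)
    have "\<theta> ^ Suc i * (k choose Suc i) * Suc i = \<theta> ^ Suc i * (real (k - i) * (k choose i))"
      by (metis (no_types, lifting) Suc_times_choose_Suc mult.assoc mult.commute of_nat_mult)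
    also have "\<dots> = (\<theta> ^ i * (k choose i)) * (\<theta> * real (k - i))" by simp
    also have "\<dots> \<le> (k' choose i) * real (k' - i)"
      using Suc step[of i] \<theta> by (intro mult_mono) auto
    also have "\<dots> = real (k' choose Suc i) * Suc i"
      by (metis Suc_times_choose_Suc mult.commute of_nat_mult)
    finally show ?case by (simp only: mult_le_cancel_right_pos of_nat_0_less_iff zero_less_Suc)
  qed simp
  have "\<theta> ^ r * binomial_ball k r = (\<Sum>i\<le>r. \<theta> ^ r * (k choose i))"
    by (simp add: binomial_ball_def sum_distrib_left)
  also have "\<dots> \<le> (\<Sum>i\<le>r. \<theta> ^ i * (k choose i))"
    using \<theta> by (intro sum_mono mult_right_mono power_decreasing) auto
  also have "\<dots> \<le> (\<Sum>i\<le>r. real (k' choose i))"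
    by (rule sum_mono) (use choose in auto)
  finally show ?thesis by (simp add: binomial_ball_def)
qed

text \<open>Enlarging the radius by \<open>t\<close> gains \<open>1 + c / 8\<close> per layer,
  because all radii are at most \<open>(1 / 2 - c / 16) * k\<close>. Dropping \<open>m\<close>
  coordinates costs \<open>1 - 2 * \<eta>\<close> per layer: below the middle \<open>k - j\<close>
  is at least \<open>k / 2\<close>, so \<open>m\<close> is at most \<open>2 * \<eta>\<close> times
  \<open>k - j\<close>.\<close>

lemma binomial_ball_growth:
  fixes c \<eta> :: real
  assumes c: "0 < c" "c \<le> 1" and \<eta>: "0 \<le> \<eta>" "\<eta> \<le> 1 / 2"
    and r: "r \<le> (1 / 2 - c / 8) * k" and t: "t \<le> c / 16 * k" and m: "m \<le> \<eta> * k"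
  shows "(1 - 2 * \<eta>) ^ (r + t) * ((1 + c / 8) ^ t * binomial_ball k r) \<le> binomial_ball (k - m) (r + t)"
proof -
  have rt: "real (r + t) \<le> (1 / 2 - c / 16) * k" using r t by (simp add: algebra_simps)
  have rt2: "real (r + t) \<le> k / 2"
  proof -
    have "(1 / 2 - c / 16) * real k \<le> 1 / 2 * k" using c by (intro mult_right_mono) auto
    with rt show ?thesis by simp
  qed
  have "(1 + c / 8) ^ t * binomial_ball k r \<le> binomial_ball k (r + t)"
  proof (rule binomial_ball_shift)
    fix j assume j: "j < r + t"
    \<comment> \<open>The growth rate \<open>1 + c / 8\<close> and the margin \<open>c / 16\<close>
      are matched so that the terms linear in \<open>c\<close> cancel.\<close>
    have "(1 + c / 8) * real (Suc j) \<le> (1 + c / 8) * ((1 / 2 - c / 16) * k)"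
      using j rt c by (intro mult_left_mono) auto
    also have "\<dots> = (1 / 2 - c\<^sup>2 / 128) * k" by (simp add: field_simps power2_eq_square)
    also have "\<dots> \<le> (1 / 2) * real k" by (intro mult_right_mono) auto
    also have "\<dots> \<le> real (k - j)" using j rt2 by linarith
    finally show "(1 + c / 8) * real (Suc j) \<le> real (k - j)" .
  qed (use c in auto)
  then have "(1 - 2 * \<eta>) ^ (r + t) * ((1 + c / 8) ^ t * binomial_ball k r)
      \<le> (1 - 2 * \<eta>) ^ (r + t) * binomial_ball k (r + t)"
    using \<eta> by (intro mult_left_mono) auto
  also have "\<dots> \<le> binomial_ball (k - m) (r + t)"
  proof (rule binomial_ball_fewer)
    fix j assume j: "j < r + t"
    then have jk2: "real j \<le> real k / 2" using rt2 by linarith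
    then have jk: "k \<le> 2 * (k - real j)" by (simp add: field_simps)
    have "real k / 2 \<le> real k" by simp
    with jk2 have "real j \<le> real k" by (rule order.trans)
    then have jk': "real (k - j) = k - real j" by (simp add: of_nat_diff)
    have "\<eta> * k \<le> \<eta> * (2 * (k - real j))" using jk \<eta> by (intro mult_left_mono) auto
    then have "(1 - 2 * \<eta>) * (k - real j) \<le> k - real j - m" using m by (simp add: algebra_simps)
    also have "\<dots> \<le> real (k - m - j)" by linarith
    finally show "(1 - 2 * \<eta>) * real (k - j) \<le> real (k - m - j)" by (simp add: jk')
  qed (use \<eta> in auto)
  finally show ?thesis .
qed

text \<open>A single layer suffices. The central one has at least \<open>2 ^ k / (k + 1)\<close>
  points, and descending about \<open>c * k / 4\<close> layers costs at most 4 per layer, in total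
  \<open>2 powr (c / 2 * k)\<close>. The remaining factor of that size absorbs
  \<open>k + 1\<close>.\<close>

lemma eventually_le_binomial_ball:
  fixes c :: real
  assumes c: "0 < c" "c \<le> 1"
  shows "\<forall>\<^sub>F k :: nat in sequentially. \<exists>r. r \<le> (1 / 2 - c / 8) * k \<and> 2 powr ((1 - c) * k) \<le> binomial_ball k r"
proof -
  have "\<forall>\<^sub>F k :: nat in sequentially. real k + 1 \<le> 2 powr (c / 2 * k)"
    using c by real_asymp
  moreover have "\<forall>\<^sub>F k :: nat in sequentially. 1 \<le> c / 8 * k"
    using c by real_asymp
  ultimately show ?thesis
  proof eventually_elim
    case (elim k)
    define s where "s = nat \<lfloor>c / 4 * k\<rfloor>"
    have s: "real s \<le> c / 4 * k" "c / 4 * k - 1 \<le> real s"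
      unfolding s_def by (rule nat_floor_le, use c in simp) (rule nat_floor_ge)
    have "c / 4 * k \<le> 1 / 4 * k" using c by (intro mult_right_mono) auto
    with s have s4: "4 * s \<le> k" by linarith
    define r where "r = k div 2 - s"
    have "real r \<le> k / 2 - s" using s4 unfolding r_def by linarith
    \<comment> \<open>Rounding in \<open>s\<close> loses at most 1, paid for by
      \<open>c / 8 * k\<close>; this is why the margin is \<open>c / 8\<close> and not
      \<open>c / 4\<close>.\<close>
    also have "\<dots> \<le> (1 / 2 - c / 8) * k" using s elim by (simp add: algebra_simps)
    finally have r: "r \<le> (1 / 2 - c / 8) * k" .
    have "(3::real) ^ s \<le> 4 ^ s" by (intro power_mono) auto
    also have "(4::real) ^ s = 2 powr (2 * s)"
      by (simp add: powr_realpow[symmetric] powr_powr[symmetric])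
    also have "\<dots> \<le> 2 powr (c / 2 * k)" using s by (intro powr_mono) auto
    finally have s3: "(3::real) ^ s \<le> 2 powr (c / 2 * k)" .
    have "2 powr (c / 2 * k) * (2 powr (c / 2 * k) * 2 powr ((1 - c) * k)) = 2 ^ k"
      by (simp add: powr_add[symmetric] powr_realpow[symmetric] algebra_simps)
    also have "2 ^ k \<le> real (Suc k * (k choose (k div 2)))"
      using two_power_le_central_binomial[of k] by (metis of_nat_le_iff of_nat_numeral of_nat_power)
    also have "\<dots> \<le> real (Suc k * (3 ^ s * (k choose r)))"
      unfolding of_nat_le_iff r_def by (intro mult_left_mono central_binomial_le_three_power s4) auto
    also have "\<dots> = (real k + 1) * (3 ^ s * (k choose r))" by (simp add: algebra_simps)
    also have "\<dots> \<le> 2 powr (c / 2 * k) * (2 powr (c / 2 * k) * (k choose r))"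
      using elim(1) s3 by (intro mult_mono) (auto intro!: mult_right_mono)
    finally have "2 powr ((1 - c) * k) \<le> k choose r" by simp
    also have "real (k choose r) \<le> binomial_ball k r"
      unfolding of_nat_le_iff binomial_ball_def by (rule member_le_sum) auto
    finally show ?case using r by blast
  qed
qed

text \<open>The last conclusion concerns the failure bound of \<open>prob_not_covered_le\<close>,
  with \<open>t\<close> the increase of the radius, \<open>m\<close> the number of generators set
  aside and \<open>\<epsilon>\<close> the tolerated uncovered fraction. Enlarging the radius beats
  the loss from setting generators aside, and \<open>\<epsilon> ^ m\<close> beats \<open>n\<close>.
  The \<open>+ 1\<close> leaves room for the final generator.\<close>

lemma tendsto_0_failure_bound:
  fixes n k D :: "nat \<Rightarrow> nat" and c \<delta> :: real
  assumes c: "0 < c" "c \<le> 1" and \<delta>: "0 < \<delta>"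
    and k: "filterlim k at_top sequentially" and D: "filterlim D at_top sequentially"
    and npos: "\<And>N. n N > 0"
    and nk: "\<forall>\<^sub>F N in sequentially. n N \<le> 2 ^ k N"
    and nD: "\<forall>\<^sub>F N in sequentially. n N \<le> binomial_ball (k N) (D N)"
    and Dk: "\<forall>\<^sub>F N in sequentially. real (D N) \<le> (1 / 2 - c / 8) * k N"
  obtains t m :: "nat \<Rightarrow> nat" and \<epsilon> :: real where "\<epsilon> > 0"
    "\<forall>\<^sub>F N in sequentially. m N \<le> k N \<and> real (D N + t N + 1) \<le> (1 + \<delta>) * D N"
    "(\<lambda>N. n N / (binomial_ball (k N - m N) (D N + t N) * \<epsilon>) + n N * \<epsilon> ^ m N) \<longlonglongrightarrow> 0"
proof -
  \<comment> \<open>The cap \<open>c / 8\<close> keeps \<open>t\<close> at most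
    \<open>c / 16 * k\<close>, as \<open>binomial_ball_growth\<close> demands.\<close>
  define d where "d = min \<delta> (c / 8)"
  have d: "0 < d" "d \<le> \<delta>" "d \<le> c / 8" "d \<le> 1" using c \<delta> by (auto simp: d_def)
  define l where "l = 1 + c / 8"
  have l: "l > 1" using c by (simp add: l_def)
  \<comment> \<open>Over at most \<open>2 * D\<close> layers the loss is then no worse than
    \<open>l powr (- d / 4 * D)\<close>, half of the exponent gained by enlarging the radius by
    about \<open>d / 2 * D\<close>.\<close>
  define \<eta> where "\<eta> = (1 - l powr (- d / 8)) / 2"
  have lp: "l powr (- d / 8) < 1" "l powr (- d / 8) > 0"
    using l d powr_less_cancel_iff[of l "- d / 8" 0] by auto
  have \<eta>: "0 < \<eta>" "\<eta> < 1 / 2" "1 - 2 * \<eta> = l powr (- d / 8)" using lp by (auto simp: \<eta>_def field_simps)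
  \<comment> \<open>Chosen so that \<open>\<epsilon> powr \<eta> = 1 / 4\<close>: up to a constant
    factor \<open>\<epsilon> ^ m\<close> is then at most \<open>4 powr (- k)\<close>, while
    \<open>n\<close> is at most \<open>2 ^ k\<close>.\<close>
  define \<epsilon> where "\<epsilon> = (4::real) powr (- 1 / \<eta>)"
  have \<epsilon>: "\<epsilon> > 0" by (simp add: \<epsilon>_def)
  define t where "t N = nat \<lfloor>d / 2 * D N\<rfloor>" for N
  define m where "m N = nat \<lfloor>\<eta> * k N\<rfloor>" for N
  have t: "real (t N) \<le> d / 2 * D N" "d / 2 * D N - 1 \<le> real (t N)" for N
    unfolding t_def by (rule nat_floor_le, use d in simp) (rule nat_floor_ge)
  have m: "real (m N) \<le> \<eta> * k N" "\<eta> * k N - 1 \<le> real (m N)" for N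
    unfolding m_def by (rule nat_floor_le, use \<eta> in simp) (rule nat_floor_ge)
  have D': "filterlim (\<lambda>N. real (D N)) at_top sequentially"
    by (rule filterlim_compose[OF filterlim_real_sequentially D])
  have k': "filterlim (\<lambda>N. real (k N)) at_top sequentially"
    by (rule filterlim_compose[OF filterlim_real_sequentially k])
  have "\<forall>\<^sub>F N in sequentially. 2 / d \<le> real (D N)"
    using D' by (simp add: filterlim_at_top)
  then have small: "\<forall>\<^sub>F N in sequentially. m N \<le> k N \<and> real (D N + t N + 1) \<le> (1 + \<delta>) * D N"
  proof eventually_elim
    case (elim N)
    have "\<eta> * k N \<le> 1 * real (k N)" using \<eta> by (intro mult_right_mono) auto
    with m(1)[of N] have "m N \<le> k N" by linarith
    \<comment> \<open>The additional step takes up one half of \<open>d * D N\<close>, and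
      \<open>t\<close> the other.\<close>
    moreover have "1 \<le> d / 2 * D N" using elim d by (simp add: field_simps)
    moreover have "d * D N \<le> \<delta> * D N" using d by (intro mult_right_mono) auto
    ultimately show ?case using t(1)[of N] by (simp add: algebra_simps)
  qed
  have upper: "\<forall>\<^sub>F N in sequentially. n N / (binomial_ball (k N - m N) (D N + t N) * \<epsilon>) + n N * \<epsilon> ^ m N
      \<le> l powr (1 - d / 4 * D N) / \<epsilon> + 4 powr (1 / \<eta>) * (1 / 2) powr k N"
    using nk nD Dk
  proof eventually_elim
    case (elim N)
    let ?V = "real (binomial_ball (k N - m N) (D N + t N))"
    have tk: "real (t N) \<le> c / 16 * k N"
    proof -
      have "(1 / 2 - c / 8) * real (k N) \<le> 1 * real (k N)" using c by (intro mult_right_mono) auto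
      then have Dk1: "real (D N) \<le> k N" using elim(3) by simp
      have "d / 2 * D N \<le> c / 16 * k N" using d Dk1 c by (intro mult_mono) auto
      with t(1)[of N] show ?thesis by linarith
    qed
    have tD: "D N + t N \<le> 2 * D N"
    proof -
      have "d / 2 * D N \<le> 1 * real (D N)" using d by (intro mult_right_mono) auto
      with t(1)[of N] show ?thesis by linarith
    qed
    \<comment> \<open>Loss times gain; the \<open>- 1\<close> stems from rounding \<open>t\<close>
      down.\<close>
    have "l powr (d / 4 * D N - 1) = l powr (- d / 4 * D N) * l powr (d / 2 * D N - 1)"
      unfolding powr_add[symmetric] by (rule arg_cong[where f = "(powr) l"]) (simp add: field_simps)
    then have "l powr (d / 4 * D N - 1) * n N
        = l powr (- d / 4 * D N) * (l powr (d / 2 * D N - 1) * n N)" by simp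
    also have "\<dots> \<le> (1 - 2 * \<eta>) ^ (D N + t N) * (l ^ t N * binomial_ball (k N) (D N))"
    proof (intro mult_mono)
      have "l powr (- d / 4 * D N) = (1 - 2 * \<eta>) ^ (2 * D N)"
        using lp(2) unfolding \<eta>(3) by (simp add: powr_realpow[symmetric] powr_powr)
      also have "\<dots> \<le> (1 - 2 * \<eta>) ^ (D N + t N)"
        using \<eta> tD by (intro power_decreasing) auto
      finally show "l powr (- d / 4 * D N) \<le> (1 - 2 * \<eta>) ^ (D N + t N)" .
      have "l powr (d / 2 * D N - 1) \<le> l powr (t N)"
        using l t(2)[of N] by (intro powr_mono) auto
      also have "\<dots> = l ^ t N" using l by (simp add: powr_realpow)
      finally show "l powr (d / 2 * D N - 1) \<le> l ^ t N" .
    qed (use elim l \<eta> in auto)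
    also have "\<dots> \<le> ?V"
      unfolding l_def using binomial_ball_growth[OF c, of \<eta> "D N" "k N" "t N" "m N"] \<eta> elim(3) tk m by simp
    finally have V: "l powr (d / 4 * D N - 1) * n N \<le> ?V" .
    have pos: "0 < l powr (d / 4 * D N - 1) * n N" using l npos by simp
    have "n N / (?V * \<epsilon>) \<le> n N / (l powr (d / 4 * D N - 1) * n N * \<epsilon>)"
      using V pos \<epsilon> npos[of N] by (intro divide_left_mono mult_right_mono mult_pos_pos) auto
    also have "\<dots> = l powr (1 - d / 4 * D N) / \<epsilon>"
    proof -
      have "1 - d / 4 * D N = - (d / 4 * D N - 1)" by simp
      then have e: "l powr (1 - d / 4 * D N) = 1 / l powr (d / 4 * D N - 1)"
        by (simp only: powr_minus_divide)
      show ?thesis unfolding e using npos[of N] \<epsilon> l by (simp add: divide_simps)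
    qed
    finally have *: "n N / (?V * \<epsilon>) \<le> l powr (1 - d / 4 * D N) / \<epsilon>" .
    have "n N * \<epsilon> ^ m N \<le> 2 powr k N * 4 powr (1 / \<eta> - k N)"
    proof (intro mult_mono)
      show "real (n N) \<le> 2 powr k N" using elim(1) by (simp add: powr_realpow flip: of_nat_le_iff)
      have "\<epsilon> ^ m N = 4 powr (- (m N / \<eta>))" by (simp add: \<epsilon>_def powr_realpow[symmetric] powr_powr)
      also have "\<dots> \<le> 4 powr (1 / \<eta> - k N)"
        using m(2)[of N] \<eta> by (intro powr_mono) (auto simp: field_simps)
      finally show "\<epsilon> ^ m N \<le> 4 powr (1 / \<eta> - k N)" .
    qed (use \<epsilon> in auto)
    also have "\<dots> = 4 powr (1 / \<eta>) * (1 / 2) powr k N"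
    proof -
      have "(4::real) powr k N = 2 powr k N * 2 powr k N" by (simp add: powr_mult[symmetric])
      then show ?thesis by (simp add: powr_diff powr_divide)
    qed
    finally show ?case using * by linarith
  qed
  have lim: "(\<lambda>N. l powr (1 - d / 4 * D N) / \<epsilon> + 4 powr (1 / \<eta>) * (1 / 2) powr k N) \<longlonglongrightarrow> 0"
  proof -
    have "((\<lambda>x. l powr (1 - d / 4 * x)) \<longlongrightarrow> 0) at_top" using l d by real_asymp
    from filterlim_compose[OF this D'] have 1: "(\<lambda>N. l powr (1 - d / 4 * D N)) \<longlonglongrightarrow> 0" .
    have "((\<lambda>x. (1 / 2 :: real) powr x) \<longlongrightarrow> 0) at_top" by real_asymp
    from filterlim_compose[OF this k'] have 2: "(\<lambda>N. (1 / 2 :: real) powr k N) \<longlonglongrightarrow> 0" .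
    from tendsto_add[OF tendsto_divide[OF 1 tendsto_const[of \<epsilon>]] tendsto_mult_left[OF 2, of "4 powr (1 / \<eta>)"]]
    show ?thesis using \<epsilon> by simp
  qed
  have lower: "\<forall>\<^sub>F N in sequentially.
      0 \<le> n N / (binomial_ball (k N - m N) (D N + t N) * \<epsilon>) + n N * \<epsilon> ^ m N"
    using \<epsilon> by (intro always_eventually allI add_nonneg_nonneg) simp_all
  have "(\<lambda>N. n N / (binomial_ball (k N - m N) (D N + t N) * \<epsilon>) + n N * \<epsilon> ^ m N) \<longlonglongrightarrow> 0"
    by (rule tendsto_sandwich[OF lower upper tendsto_const lim])
  with \<epsilon> small show ?thesis by (rule that)
qed

text \<open>Convergence for each fixed \<open>\<delta>\<close> is turned into one null sequence:
  \<open>\<delta> N\<close> is \<open>1 / Suc j\<close> for the largest \<open>j\<close> up to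
  \<open>N\<close> whose probability is at least \<open>1 - 1 / Suc j\<close>. Each \<open>j\<close>
  eventually qualifies, so this largest \<open>j\<close> tends to infinity.\<close>

lemma diagonal_tendsto_1:
  fixes p :: "nat \<Rightarrow> real \<Rightarrow> real"
  assumes le1: "\<And>N \<delta>. p N \<delta> \<le> 1" and lim: "\<And>\<delta>. \<delta> > 0 \<Longrightarrow> (\<lambda>N. p N \<delta>) \<longlonglongrightarrow> 1"
  obtains \<delta> where "\<delta> \<longlonglongrightarrow> 0" "\<And>N. \<delta> N > 0" "(\<lambda>N. p N (\<delta> N)) \<longlonglongrightarrow> 1"
proof -
  define good where "good N j \<longleftrightarrow> 1 - 1 / real (Suc j) \<le> p N (1 / real (Suc j))" for N j
  \<comment> \<open>The cap \<open>j \<le> N\<close> makes the set finite, and the inserted 0 is the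
    default when no \<open>j\<close> qualifies.\<close>
  define s where "s N = Max (insert 0 {j. j \<le> N \<and> good N j})" for N
  have ev: "\<forall>\<^sub>F N in sequentially. good N j" for j
  proof -
    have "1 - 1 / real (Suc j) < 1" by simp
    from order_tendstoD(1)[OF lim[of "1 / real (Suc j)"] this] show ?thesis
      unfolding good_def by (rule eventually_mono) auto
  qed
  have s: "filterlim s at_top sequentially"
    unfolding filterlim_at_top
  proof
    fix j
    show "\<forall>\<^sub>F N in sequentially. j \<le> s N"
      using ev[of j] eventually_ge_at_top[of j]
      by eventually_elim (auto simp: s_def intro!: Max_ge)
  qed
  have good: "good N (s N)" if "s N > 0" for N
  proof -
    have "s N \<in> insert 0 {j. j \<le> N \<and> good N j}" unfolding s_def by (rule Max_in) auto
    with that show ?thesis by simp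
  qed
  have "(\<lambda>j. 1 / real (Suc j)) \<longlonglongrightarrow> 0" by real_asymp
  from filterlim_compose[OF this s] have 0: "(\<lambda>N. 1 / real (Suc (s N))) \<longlonglongrightarrow> 0" .
  have "\<forall>\<^sub>F N in sequentially. 0 < s N"
    by (rule eventually_compose_filterlim[OF eventually_gt_at_top s])
  then have lower: "\<forall>\<^sub>F N in sequentially. 1 - 1 / real (Suc (s N)) \<le> p N (1 / real (Suc (s N)))"
    by (rule eventually_mono) (use good in \<open>auto simp: good_def\<close>)
  have upper: "\<forall>\<^sub>F N in sequentially. p N (1 / real (Suc (s N))) \<le> 1"
    using le1 by (intro always_eventually) simp
  have lim1: "(\<lambda>N. 1 - 1 / real (Suc (s N))) \<longlonglongrightarrow> 1"
    using tendsto_diff[OF tendsto_const 0, of 1] by simp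
  have "(\<lambda>N. p N (1 / real (Suc (s N)))) \<longlonglongrightarrow> 1"
    by (rule tendsto_sandwich[OF lower upper lim1 tendsto_const])
  with 0 show ?thesis by (intro that[of "\<lambda>N. 1 / real (Suc (s N))"]) auto
qed

section \<open>Random products over index sets\<close>

definition tuples :: "'a set \<Rightarrow> nat \<Rightarrow> 'a list set" where
  "tuples C k = {zs. set zs \<subseteq> C \<and> length zs = k}"

lemma finite_tuples: "finite C \<Longrightarrow> finite (tuples C k)"
  unfolding tuples_def by (rule finite_lists_length_eq)

lemma card_tuples: "finite C \<Longrightarrow> card (tuples C k) = card C ^ k"
  unfolding tuples_def by (rule card_lists_length_eq)

lemma tuples_0 [simp]: "tuples C 0 = {[]}"
  by (auto simp: tuples_def)

lemma bij_betw_tuples_append: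
  "bij_betw (\<lambda>(xs, ys). xs @ ys) (tuples C i \<times> tuples C j) (tuples C (i + j))"
  by (rule bij_betw_byWitness[where f' = "\<lambda>zs. (take i zs, drop i zs)"])
     (auto simp: tuples_def dest: in_set_takeD in_set_dropD)

lemma sum_tuples_Suc:
  "(\<Sum>zs\<in>tuples C (Suc k). f zs) = (\<Sum>x\<in>C. \<Sum>zs\<in>tuples C k. f (x # zs))"
proof -
  have "bij_betw (\<lambda>(x, zs). x # zs) (C \<times> tuples C k) (tuples C (Suc k))"
    by (rule bij_betw_byWitness[where f' = "\<lambda>zs. (hd zs, tl zs)"])
       (auto simp: tuples_def length_Suc_conv)
  from sum.reindex_bij_betw[OF this, of f] show ?thesis
    by (simp add: sum.cartesian_product case_prod_unfold)
qed

text \<open>Reduces probabilities of generator lists to counts over \<open>tuples\<close>.\<close>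

lemma replicate_pmf_of_set:
  assumes "finite C" "C \<noteq> {}"
  shows "replicate_pmf k (pmf_of_set C) = pmf_of_set (tuples C k)"
proof (rule pmf_eqI)
  have ne: "tuples C j \<noteq> {}" for j
    using assms card_tuples[of C j] by (metis card.empty card_eq_0_iff power_not_zero)
  show "pmf (replicate_pmf k (pmf_of_set C)) zs = pmf (pmf_of_set (tuples C k)) zs" for zs
  proof (induction k arbitrary: zs)
    case 0
    then show ?case by (simp add: pmf_of_set_singleton)
  next
    case (Suc k)
    have "pmf (replicate_pmf (Suc k) (pmf_of_set C)) zs
        = (\<Sum>x\<in>C. (\<Sum>xs\<in>tuples C k. of_bool (x # xs = zs)) / card (tuples C k)) / card C"
      using assms ne finite_tuples[OF assms(1)]
      by (simp add: pmf_eqI[OF Suc.IH] pmf_bind integral_pmf_of_set indicator_def of_bool_def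
          sum_divide_distrib mult.commute)
    also have "\<dots> = (\<Sum>ys\<in>tuples C (Suc k). of_bool (ys = zs)) / card C ^ Suc k"
      by (simp only: sum_tuples_Suc sum_divide_distrib[symmetric] card_tuples[OF assms(1)])
        (simp add: field_simps)
    also have "\<dots> = pmf (pmf_of_set (tuples C (Suc k))) zs"
      using assms ne finite_tuples[OF assms(1)] by (simp add: card_tuples indicator_def)
    finally show ?case .
  qed
qed

section \<open>Collisions and coverage of random subproducts\<close>

definition subproduct :: "('a, 'b) monoid_scheme \<Rightarrow> nat set \<Rightarrow> 'a list \<Rightarrow> 'a" where
  "subproduct G A zs = foldr (mult G) (nths zs A) (one G)"

lemma subproduct_Cons:
  "subproduct G A (x # zs) =
     (if 0 \<in> A then x \<otimes>\<^bsub>G\<^esub> subproduct G {j. Suc j \<in> A} zs else subproduct G {j. Suc j \<in> A} zs)"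
  by (simp add: subproduct_def nths_Cons)

lemma (in group) foldr_mult_closed:
  "set xs \<subseteq> carrier G \<Longrightarrow> foldr (\<otimes>) xs \<one> \<in> carrier G"
  by (induction xs) auto

lemma (in group) subproduct_closed:
  "set zs \<subseteq> carrier G \<Longrightarrow> subproduct G A zs \<in> carrier G"
  unfolding subproduct_def by (rule foldr_mult_closed) (meson order_trans set_nths_subset)

text \<open>At the first index lying in exactly one of \<open>A\<close> and \<open>B\<close>, the
  generator occurs on one side of the equation only, so exactly one of its values solves it once the
  others are fixed. The arbitrary \<open>g\<close> and \<open>h\<close> absorb the generators before
  that index, which lets the induction run in nonabelian groups too. The factor
  \<open>order G\<close> avoids a division.\<close>

lemma (in group) sum_subproduct_collisions:
  assumes fin: "finite (carrier G)"
  shows "A \<subseteq> {..<k} \<Longrightarrow> B \<subseteq> {..<k} \<Longrightarrow> A \<noteq> B \<Longrightarrow> g \<in> carrier G \<Longrightarrow> h \<in> carrier G \<Longrightarrow>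
    order G * (\<Sum>zs\<in>tuples (carrier G) k.
      of_bool (g \<otimes> subproduct G A zs = h \<otimes> subproduct G B zs)) = order G ^ k"
proof (induction k arbitrary: A B g h)
  case 0
  then show ?case by auto
next
  case (Suc k)
  let ?A = "{j. Suc j \<in> A}" and ?B = "{j. Suc j \<in> B}"
  let ?e = "\<lambda>zs. of_bool (g \<otimes> subproduct G A zs = h \<otimes> subproduct G B zs) :: nat"
  have cl: "subproduct G S zs \<in> carrier G" if "zs \<in> tuples (carrier G) k" for S zs
    using that by (auto simp: tuples_def intro: subproduct_closed)
  show ?case
  proof (cases "(0 \<in> A) = (0 \<in> B)")
    case True
    have "A = B" if "?A = ?B"
    proof (rule Set.set_eqI)
      show "i \<in> A \<longleftrightarrow> i \<in> B" for i
        using True that by (cases i) auto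
    qed
    then have ne: "?A \<noteq> ?B" using Suc.prems by blast
    have sub: "?A \<subseteq> {..<k}" "?B \<subseteq> {..<k}" using Suc.prems by auto
    have "order G * (\<Sum>zs\<in>tuples (carrier G) k. ?e (x # zs)) = order G ^ k"
      if x: "x \<in> carrier G" for x
    proof -
      \<comment> \<open>The head generator moves into the prefixes, which leaves an instance for the
        tails.\<close>
      define g' h' where "g' = (if 0 \<in> A then g \<otimes> x else g)" and "h' = (if 0 \<in> B then h \<otimes> x else h)"
      have "?e (x # zs) = of_bool (g' \<otimes> subproduct G ?A zs = h' \<otimes> subproduct G ?B zs)"
        if "zs \<in> tuples (carrier G) k" for zs
        using Suc.prems x cl[OF that] by (simp add: subproduct_Cons g'_def h'_def m_assoc)
      moreover have "g' \<in> carrier G" "h' \<in> carrier G"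
        using Suc.prems x by (auto simp: g'_def h'_def)
      ultimately show ?thesis using Suc.IH[OF sub ne] by simp
    qed
    then show ?thesis by (simp add: sum_tuples_Suc sum_distrib_left order_def)
  next
    case False
    have "(\<Sum>x\<in>carrier G. ?e (x # zs)) = 1" if zs: "zs \<in> tuples (carrier G) k" for zs
    proof -
      define s t where "s = subproduct G ?A zs" and "t = subproduct G ?B zs"
      have st: "s \<in> carrier G" "t \<in> carrier G" using cl[OF zs] by (auto simp: s_def t_def)
      have gh: "g \<in> carrier G" "h \<in> carrier G" using Suc.prems by auto
      have e1: "g \<otimes> (x \<otimes> s) = h \<otimes> t \<longleftrightarrow> x = inv g \<otimes> (h \<otimes> t) \<otimes> inv s"
        and e2: "g \<otimes> s = h \<otimes> (x \<otimes> t) \<longleftrightarrow> x = inv h \<otimes> (g \<otimes> s) \<otimes> inv t"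
        if "x \<in> carrier G" for x
        using that st gh by (metis inv_closed m_closed inv_solve_left inv_solve_right)+
      obtain y where y: "y \<in> carrier G"
        "\<And>x. x \<in> carrier G \<Longrightarrow> (g \<otimes> subproduct G A (x # zs) = h \<otimes> subproduct G B (x # zs)) \<longleftrightarrow> x = y"
      proof (cases "0 \<in> A")
        case True
        with False show ?thesis
          using e1 st gh by (intro that[of "inv g \<otimes> (h \<otimes> t) \<otimes> inv s"])
            (auto simp: subproduct_Cons s_def t_def)
      next
        case F: False
        with False show ?thesis
          using e2 st gh by (intro that[of "inv h \<otimes> (g \<otimes> s) \<otimes> inv t"])
            (auto simp: subproduct_Cons s_def t_def)
      qed
      have "(\<Sum>x\<in>carrier G. ?e (x # zs)) = (\<Sum>x\<in>carrier G. of_bool (x = y))"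
        by (rule sum.cong) (use y in auto)
      also have "\<dots> = 1" using fin y(1) by simp
      finally show ?thesis .
    qed
    then have "(\<Sum>zs\<in>tuples (carrier G) k. \<Sum>x\<in>carrier G. ?e (x # zs))
        = (\<Sum>zs\<in>tuples (carrier G) k. 1)"
      by (rule sum.cong[OF refl])
    moreover have "(\<Sum>zs\<in>tuples (carrier G) (Suc k). ?e zs)
        = (\<Sum>zs\<in>tuples (carrier G) k. \<Sum>x\<in>carrier G. ?e (x # zs))"
      unfolding sum_tuples_Suc by (rule sum.swap)
    ultimately show ?thesis
      by (simp only: card_eq_sum[symmetric] card_tuples[OF fin] order_def power_Suc)
  qed
qed

text \<open>Second moment method: \<open>\<Sum>\<^sub>g (X\<^sub>g - \<mu>)\<^sup>2\<close>, where \<open>X\<^sub>g\<close> counts the sets \<open>A \<in> F\<close> with subproduct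
  \<open>g\<close> and \<open>\<mu> = |F| / |G|\<close>, is at least \<open>\<mu>\<^sup>2\<close> times the number of uncovered elements.\<close>

lemma (in group) sum_uncovered_le:
  assumes fin: "finite (carrier G)" and F: "F \<subseteq> Pow {..<k}" "F \<noteq> {}"
  shows "(\<Sum>zs\<in>tuples (carrier G) k. real (card (carrier G - (\<lambda>A. subproduct G A zs) ` F)))
           \<le> real (order G) ^ k * (real (order G) ^ 2 / card F)"
proof -
  define n where "n = order G"
  define f where "f = real (card F)"
  define T where "T = tuples (carrier G) k"
  have finF: "finite F" using F(1) finite_subset by blast
  have f: "f > 0" using F finF by (simp add: f_def card_gt_0_iff)
  have n: "n > 0" using fin by (simp add: n_def order_gt_0_iff_finite)
  have cT: "real (card T) = real n ^ k" by (simp add: T_def card_tuples fin n_def order_def)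
  define X where "X g zs = (\<Sum>A\<in>F. of_bool (subproduct G A zs = g) :: real)" for g zs
  have cl: "subproduct G A zs \<in> carrier G" if "zs \<in> T" for A zs
    using that by (auto simp: T_def tuples_def intro: subproduct_closed)
  have X1: "(\<Sum>g\<in>carrier G. X g zs) = f" if "zs \<in> T" for zs
    using cl[OF that] fin
    by (simp add: X_def sum.swap[of _ F] f_def)
  have X2: "(\<Sum>g\<in>carrier G. X g zs ^ 2)
      = (\<Sum>A\<in>F. \<Sum>B\<in>F. of_bool (subproduct G A zs = subproduct G B zs))" if "zs \<in> T" for zs
  proof -
    have "(\<Sum>g\<in>carrier G. X g zs ^ 2)
       = (\<Sum>g\<in>carrier G. \<Sum>A\<in>F. \<Sum>B\<in>F. of_bool (subproduct G A zs = g \<and> subproduct G B zs = g))"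
      by (simp add: X_def power2_eq_square sum_product of_bool_conj)
    also have "\<dots> = (\<Sum>A\<in>F. \<Sum>B\<in>F. \<Sum>g\<in>carrier G. of_bool (subproduct G A zs = g \<and> subproduct G B zs = g))"
      by (subst sum.swap) (simp add: sum.swap[of _ "carrier G" F])
    also have "\<dots> = (\<Sum>A\<in>F. \<Sum>B\<in>F. of_bool (subproduct G A zs = subproduct G B zs))"
    proof (intro sum.cong refl)
      fix A B
      have "(\<Sum>g\<in>carrier G. of_bool (subproduct G A zs = g \<and> subproduct G B zs = g))
          = (\<Sum>g\<in>carrier G. if g = subproduct G A zs then of_bool (subproduct G A zs = subproduct G B zs) else 0::real)"
        by (rule sum.cong) auto
      then show "(\<Sum>g\<in>carrier G. of_bool (subproduct G A zs = g \<and> subproduct G B zs = g))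
          = (of_bool (subproduct G A zs = subproduct G B zs) :: real)"
        using cl[OF that] fin by simp
    qed
    finally show ?thesis .
  qed
  \<comment> \<open>The term \<open>1 / n\<close> is granted to the diagonal as well, so that the
    double sum over \<open>F\<close> is \<open>f + f ^ 2 / n\<close> up to the factor
    \<open>n ^ k\<close>; its second part cancels the squared mean.\<close>
  have coll: "(\<Sum>zs\<in>T. of_bool (subproduct G A zs = subproduct G B zs))
      \<le> real n ^ k * (of_bool (A = B) + 1 / n)" if "A \<in> F" "B \<in> F" for A B
  proof (cases "A = B")
    case True
    then show ?thesis using cT by (simp add: field_simps)
  next
    case False
    have "n * (\<Sum>zs\<in>T. of_bool (subproduct G A zs = subproduct G B zs)) = n ^ k"
      using sum_subproduct_collisions[OF fin, of A k B \<one> \<one>] that F False cl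
      by (simp add: T_def n_def subset_iff cong: sum.cong)
    then have "real n * (\<Sum>zs\<in>T. of_bool (subproduct G A zs = subproduct G B zs)) = real n ^ k"
      by (metis (mono_tags, lifting) of_nat_mult of_nat_power of_nat_sum of_nat_of_bool sum.cong)
    then show ?thesis using False n by (simp add: field_simps)
  qed
  have "(\<Sum>zs\<in>T. card (carrier G - (\<lambda>A. subproduct G A zs) ` F) * (f / n) ^ 2)
      \<le> (\<Sum>zs\<in>T. \<Sum>g\<in>carrier G. (X g zs - f / n) ^ 2)"
  proof (rule sum_mono)
    fix zs
    let ?U = "carrier G - (\<lambda>A. subproduct G A zs) ` F"
    have "card ?U * (f / n) ^ 2 = (\<Sum>g\<in>?U. (X g zs - f / n) ^ 2)"
    proof -
      have "X g zs = 0" if "g \<in> ?U" for g using that by (auto simp: X_def intro!: sum.neutral)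
      then show ?thesis by simp
    qed
    also have "\<dots> \<le> (\<Sum>g\<in>carrier G. (X g zs - f / n) ^ 2)"
      by (rule sum_mono2) (use fin in auto)
    finally show "card ?U * (f / n) ^ 2 \<le> (\<Sum>g\<in>carrier G. (X g zs - f / n) ^ 2)" .
  qed
  \<comment> \<open>The counts sum to \<open>f\<close> for every \<open>zs\<close>, so their mean
    over \<open>g\<close> is exactly \<open>f / n\<close> and the cross term simplifies.\<close>
  also have "\<dots> = (\<Sum>zs\<in>T. (\<Sum>g\<in>carrier G. X g zs ^ 2) - f ^ 2 / n)"
  proof (rule sum.cong[OF refl])
    fix zs assume zs: "zs \<in> T"
    have "(\<Sum>g\<in>carrier G. (X g zs - f / n) ^ 2)
       = (\<Sum>g\<in>carrier G. X g zs ^ 2) - 2 * (f / n) * (\<Sum>g\<in>carrier G. X g zs) + n * (f / n) ^ 2"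
      by (simp add: power2_diff sum.distrib sum_subtractf sum_distrib_left sum_divide_distrib
          n_def order_def mult_ac)
    also have "\<dots> = (\<Sum>g\<in>carrier G. X g zs ^ 2) - f ^ 2 / n"
      using n by (simp add: X1[OF zs] field_simps power2_eq_square)
    finally show "(\<Sum>g\<in>carrier G. (X g zs - f / n) ^ 2) = \<dots>" .
  qed
  also have "\<dots> = (\<Sum>A\<in>F. \<Sum>B\<in>F. \<Sum>zs\<in>T. of_bool (subproduct G A zs = subproduct G B zs))
      - real n ^ k * (f ^ 2 / n)"
  proof -
    have "(\<Sum>zs\<in>T. \<Sum>g\<in>carrier G. X g zs ^ 2)
      = (\<Sum>zs\<in>T. \<Sum>A\<in>F. \<Sum>B\<in>F. of_bool (subproduct G A zs = subproduct G B zs))"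
      by (rule sum.cong) (use X2 in auto)
    also have "\<dots> = (\<Sum>A\<in>F. \<Sum>B\<in>F. \<Sum>zs\<in>T. of_bool (subproduct G A zs = subproduct G B zs))"
      by (subst sum.swap) (simp add: sum.swap[of _ T F])
    finally show ?thesis by (simp add: sum_subtractf cT)
  qed
  also have "\<dots> \<le> (\<Sum>A\<in>F. \<Sum>B\<in>F. real n ^ k * (of_bool (A = B) + 1 / n)) - real n ^ k * (f ^ 2 / n)"
    by (intro diff_right_mono sum_mono coll)
  also have "\<dots> = real n ^ k * f"
  proof -
    have "(\<Sum>A\<in>F. \<Sum>B\<in>F. (of_bool (A = B) + 1 / n)) = f + f ^ 2 / n"
      using finF by (simp add: sum.distrib f_def power2_eq_square algebra_simps)
    then show ?thesis by (simp only: sum_distrib_left[symmetric]) (simp add: algebra_simps)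
  qed
  finally have "(\<Sum>zs\<in>T. real (card (carrier G - (\<lambda>A. subproduct G A zs) ` F))) * (f / n) ^ 2 \<le> real n ^ k * f"
    by (simp add: sum_distrib_right)
  then have "(\<Sum>zs\<in>T. real (card (carrier G - (\<lambda>A. subproduct G A zs) ` F))) \<le> real n ^ k * f / (f / n) ^ 2"
    using f n by (simp add: pos_le_divide_eq)
  also have "\<dots> = real n ^ k * (real n ^ 2 / f)"
    using f n by (simp add: field_simps power2_eq_square)
  finally show ?thesis by (simp add: T_def n_def f_def)
qed

text \<open>Let \<open>U\<close> be the set missed by the first \<open>i\<close> generators. By
  Markov's inequality and \<open>sum_uncovered_le\<close>, \<open>U\<close> exceeds the fraction
  \<open>\<epsilon>\<close> of the group with probability at most the first term. Otherwise
  \<open>v\<close> is missed only if \<open>v \<otimes> inv w\<close> lies in \<open>U\<close> for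
  all \<open>j\<close> remaining generators \<open>w\<close>, which has probability at most
  \<open>\<epsilon> ^ j\<close>; a union bound over \<open>v\<close> gives the factor
  \<open>order G\<close>.\<close>

lemma (in group) prob_not_covered_le:
  fixes \<epsilon> :: real
  assumes fin: "finite (carrier G)" and F: "F \<subseteq> Pow {..<i}" "F \<noteq> {}" and \<epsilon>: "\<epsilon> > 0"
  shows "measure_pmf.prob (uniform_generators G (i + j))
           {zs. \<not> (\<forall>v\<in>carrier G. \<exists>A\<in>F. \<exists>w\<in>set (drop i zs). v = subproduct G A (take i zs) \<otimes> w)}
         \<le> real (order G) / (card F * \<epsilon>) + real (order G) * \<epsilon> ^ j"
proof -
  define n where "n = order G"
  define C where "C = carrier G"
  define U where "U xs = C - (\<lambda>A. subproduct G A xs) ` F" for xs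
  define bad where "bad xs ys \<longleftrightarrow> \<not> (\<forall>v\<in>C. \<exists>A\<in>F. \<exists>w\<in>set ys. v = subproduct G A xs \<otimes> w)" for xs ys
  have n: "n > 0" using fin by (simp add: n_def order_gt_0_iff_finite)
  have finC: "finite C" and cC: "card C = n" and neC: "C \<noteq> {}"
    using fin by (auto simp: C_def n_def order_def)
  \<comment> \<open>Markov's inequality is built in: for large \<open>U xs\<close> the first summand
    alone is at least the trivial count \<open>n ^ j\<close>.\<close>
  have bad_le: "(\<Sum>ys\<in>tuples C j. of_bool (bad xs ys))
      \<le> real n ^ j * (card (U xs) / (\<epsilon> * n)) + n * (\<epsilon> * n) ^ j" if xs: "xs \<in> tuples C i" for xs
  proof -
    have cU: "finite (U xs)" by (simp add: U_def finC)
    have "card {ys \<in> tuples C j. bad xs ys} \<le> card (\<Union>v\<in>C. tuples ((\<lambda>u. inv u \<otimes> v) ` U xs) j)"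
    proof (rule card_mono)
      show "finite (\<Union>v\<in>C. tuples ((\<lambda>u. inv u \<otimes> v) ` U xs) j)"
        using finC cU by (auto intro: finite_tuples)
      \<comment> \<open>For a missed \<open>v\<close>, each entry \<open>w\<close> of
        \<open>ys\<close> has the form \<open>inv u \<otimes> v\<close> with \<open>u\<close>
        uncovered, which leaves at most \<open>card (U xs)\<close> choices per entry.\<close>
      show "{ys \<in> tuples C j. bad xs ys} \<subseteq> (\<Union>v\<in>C. tuples ((\<lambda>u. inv u \<otimes> v) ` U xs) j)"
      proof
        fix ys assume "ys \<in> {ys \<in> tuples C j. bad xs ys}"
        then obtain v where v: "v \<in> C" and ys: "set ys \<subseteq> C" "length ys = j"
          and nv: "\<And>A w. A \<in> F \<Longrightarrow> w \<in> set ys \<Longrightarrow> v \<noteq> subproduct G A xs \<otimes> w"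
          by (auto simp: bad_def tuples_def)
        have "w \<in> (\<lambda>u. inv u \<otimes> v) ` U xs" if w: "w \<in> set ys" for w
        proof (rule image_eqI)
          have wC: "w \<in> carrier G" "v \<in> carrier G" using w ys v by (auto simp: C_def)
          then show "w = inv (v \<otimes> inv w) \<otimes> v" by (simp add: inv_mult_group m_assoc)
          have "v \<otimes> inv w \<noteq> subproduct G A xs" if "A \<in> F" for A
          proof
            assume "v \<otimes> inv w = subproduct G A xs"
            then have "subproduct G A xs = v \<otimes> inv w" by (rule sym)
            then have "subproduct G A xs \<otimes> w = v" using wC by (simp add: m_assoc)
            with nv[OF that w] show False by simp
          qed
          then have "v \<otimes> inv w \<notin> (\<lambda>A. subproduct G A xs) ` F" by blast
          with wC show "v \<otimes> inv w \<in> U xs" by (simp add: U_def C_def)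
        qed
        with v ys show "ys \<in> (\<Union>v\<in>C. tuples ((\<lambda>u. inv u \<otimes> v) ` U xs) j)"
          by (auto simp: tuples_def)
      qed
    qed
    also have "\<dots> \<le> (\<Sum>v\<in>C. card (tuples ((\<lambda>u. inv u \<otimes> v) ` U xs) j))"
      by (rule card_UN_le[OF finC])
    also have "\<dots> \<le> (\<Sum>v\<in>C. card (U xs) ^ j)"
      using cU by (intro sum_mono) (simp add: card_tuples power_mono card_image_le)
    finally have "card {ys \<in> tuples C j. bad xs ys} \<le> n * card (U xs) ^ j"
      using cC by simp
    then have "real (card {ys \<in> tuples C j. bad xs ys}) \<le> real n * real (card (U xs)) ^ j"
      by (metis of_nat_le_iff of_nat_mult of_nat_power)
    then have le1: "(\<Sum>ys\<in>tuples C j. of_bool (bad xs ys)) \<le> real n * real (card (U xs)) ^ j"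
      using finite_tuples[OF finC] by (simp add: Int_def)
    have le2: "(\<Sum>ys\<in>tuples C j. of_bool (bad xs ys)) \<le> real n ^ j"
    proof -
      have "(\<Sum>ys\<in>tuples C j. of_bool (bad xs ys)) \<le> (\<Sum>ys\<in>tuples C j. 1::real)"
        by (rule sum_mono) auto
      also have "\<dots> = real n ^ j" using finC cC by (simp add: card_tuples)
      finally show ?thesis .
    qed
    show ?thesis
    proof (cases "card (U xs) \<le> \<epsilon> * n")
      case True
      then have "real n * real (card (U xs)) ^ j \<le> n * (\<epsilon> * n) ^ j"
        by (intro mult_left_mono power_mono) auto
      moreover have "real n ^ j * (card (U xs) / (\<epsilon> * n)) \<ge> 0" using \<epsilon> by simp
      ultimately show ?thesis using le1 by linarith
    next
      case False
      then have "1 \<le> card (U xs) / (\<epsilon> * n)" using \<epsilon> n by (simp add: le_divide_eq)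
      then have "real n ^ j * 1 \<le> real n ^ j * (card (U xs) / (\<epsilon> * n))"
        by (intro mult_left_mono) auto
      moreover have "real n * (\<epsilon> * n) ^ j \<ge> 0" using \<epsilon> by simp
      ultimately show ?thesis using le2 by linarith
    qed
  qed
  have "measure_pmf.prob (uniform_generators G (i + j)) {zs. bad (take i zs) (drop i zs)}
      = (\<Sum>zs\<in>tuples C (i + j). of_bool (bad (take i zs) (drop i zs))) / real n ^ (i + j)"
  proof -
    have "tuples C (i + j) \<noteq> {}"
      using card_tuples[OF finC, of "i + j"] cC n by (metis card.empty power_not_zero less_irrefl)
    then show ?thesis
      using finC neC finite_tuples[OF finC]
      by (simp add: uniform_generators_def replicate_pmf_of_set C_def[symmetric]
          measure_pmf_of_set card_tuples cC)
  qed
  also have "(\<Sum>zs\<in>tuples C (i + j). of_bool (bad (take i zs) (drop i zs)))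
      = (\<Sum>xs\<in>tuples C i. \<Sum>ys\<in>tuples C j. of_bool (bad xs ys) :: real)"
    unfolding sum.cartesian_product
    by (subst sum.reindex_bij_betw[OF bij_betw_tuples_append, symmetric])
       (auto intro!: sum.cong simp: tuples_def)
  also have "\<dots> \<le> (\<Sum>xs\<in>tuples C i. real n ^ j * (card (U xs) / (\<epsilon> * n)) + n * (\<epsilon> * n) ^ j)"
    by (rule sum_mono) (rule bad_le)
  also have "\<dots> = real n ^ j / (\<epsilon> * n) * (\<Sum>xs\<in>tuples C i. real (card (U xs))) + n ^ i * (n * (\<epsilon> * n) ^ j)"
    using finC cC by (simp add: sum.distrib sum_distrib_left card_tuples mult.assoc)
  also have "\<dots> \<le> real n ^ j / (\<epsilon> * n) * (real n ^ i * (real n ^ 2 / card F)) + n ^ i * (n * (\<epsilon> * n) ^ j)"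
    using sum_uncovered_le[OF fin F] \<epsilon>
    by (intro add_right_mono mult_left_mono) (auto simp: C_def n_def U_def)
  also have "\<dots> = (n / (card F * \<epsilon>) + n * \<epsilon> ^ j) * real n ^ (i + j)"
    using n \<epsilon> by (simp add: field_simps power_add power_mult_distrib power2_eq_square)
  finally show ?thesis
    using n by (simp add: divide_right_mono n_def bad_def C_def divide_le_eq order_def)
qed

section \<open>Diameters of Cayley graphs\<close>

text \<open>Stated for any digraph containing arcs from \<open>u\<close> to
  \<open>u \<otimes> z\<close>, so that it serves both Cayley graphs.\<close>

lemma (in group) awalk_of_word:
  assumes "wf_digraph D" "verts D = carrier G"
    and arc: "\<And>u z. u \<in> carrier G \<Longrightarrow> z \<in> Z \<Longrightarrow> \<exists>a\<in>arcs D. tail D a = u \<and> head D a = u \<otimes> z"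
    and "Z \<subseteq> carrier G" "set xs \<subseteq> Z" "u \<in> carrier G"
  shows "\<exists>p. pre_digraph.awalk D u p (u \<otimes> foldr (\<otimes>) xs \<one>) \<and> length p = length xs"
  using assms(5,6)
proof (induction xs arbitrary: u)
  case Nil
  interpret D: wf_digraph D by fact
  show ?case using Nil assms(2) by (auto simp: D.awalk_Nil_iff)
next
  case (Cons x xs)
  interpret D: wf_digraph D by fact
  have x: "x \<in> carrier G" "set xs \<subseteq> carrier G" using Cons.prems assms(4) by auto
  from Cons.prems obtain a where a: "a \<in> arcs D" "tail D a = u" "head D a = u \<otimes> x"
    using arc[of u x] by auto
  from Cons obtain p where p: "D.awalk (u \<otimes> x) p (u \<otimes> x \<otimes> foldr (\<otimes>) xs \<one>)" "length p = length xs"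
    using x by (metis list.set_intros(2) m_closed subset_code(1))
  with a Cons.prems x have "D.awalk u (a # p) (u \<otimes> foldr (\<otimes>) (x # xs) \<one>)"
    by (simp add: D.awalk_Cons_iff m_assoc foldr_mult_closed)
  then show ?case using p by (metis length_Cons)
qed

lemma (in wf_digraph) awalk_cost_1: "awalk_cost (\<lambda>_. 1) p = real (length p)"
  by (induction p) auto

text \<open>Only products of generators are allowed, no inverses, so this one event bounds the
  directed and the undirected diameter alike. The length bound is real to admit
  \<open>(1 + \<delta>) * D\<close>.\<close>

definition words_cover :: "('a, 'b) monoid_scheme \<Rightarrow> 'a list \<Rightarrow> real \<Rightarrow> bool" where
  "words_cover G zs x \<longleftrightarrow> (\<forall>v\<in>carrier G. \<exists>xs. set xs \<subseteq> set zs \<and> real (length xs) \<le> x \<and>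
     foldr (mult G) xs (one G) = v)"

lemma words_cover_mono: "words_cover G zs x \<Longrightarrow> x \<le> y \<Longrightarrow> words_cover G zs y"
  unfolding words_cover_def by (meson order_trans)

lemma (in group) words_cover_if_subproducts:
  assumes zs: "set zs \<subseteq> carrier G"
    and F: "\<And>A. A \<in> F \<Longrightarrow> finite A \<and> card A \<le> L"
    and cov: "\<forall>v\<in>carrier G. \<exists>A\<in>F. \<exists>w\<in>set (drop i zs). v = subproduct G A (take i zs) \<otimes> w"
  shows "words_cover G zs (real (L + 1))"
  unfolding words_cover_def
proof
  fix v assume "v \<in> carrier G"
  with cov obtain A w where A: "A \<in> F" and w: "w \<in> set (drop i zs)"
    and eq: "v = subproduct G A (take i zs) \<otimes> w" by blast
  let ?xs = "nths (take i zs) A @ [w]"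
  have sub: "set ?xs \<subseteq> set zs"
    using w by (auto dest!: in_set_nthsD in_set_takeD in_set_dropD)
  have wC: "w \<in> carrier G" and xsC: "set (nths (take i zs) A) \<subseteq> carrier G" using sub zs by auto
  have "foldr (\<otimes>) (xs @ [w]) \<one> = foldr (\<otimes>) xs \<one> \<otimes> w" if "set xs \<subseteq> carrier G" for xs
    using that wC by (induction xs) (auto simp: m_assoc foldr_mult_closed)
  then have "foldr (\<otimes>) ?xs \<one> = v" using xsC eq by (simp add: subproduct_def)
  moreover have "length ?xs \<le> L + 1"
  proof -
    \<comment> \<open>Finiteness of \<open>A\<close> matters: an infinite set has
      \<open>card\<close> 0, which bounds nothing.\<close>
    have "card {j. j < length (take i zs) \<and> j \<in> A} \<le> card A"
      using F[OF A] by (intro card_mono) auto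
    then show ?thesis using F[OF A] by (simp add: length_nths)
  qed
  then have "real (length ?xs) \<le> real (L + 1)" by (rule of_nat_mono)
  ultimately show "\<exists>xs. set xs \<subseteq> set zs \<and> real (length xs) \<le> real (L + 1) \<and> foldr (\<otimes>) xs \<one> = v"
    using sub by blast
qed

text \<open>Left translation: a word for \<open>inv u \<otimes> v\<close> labels a walk from
  \<open>u\<close> to \<open>v\<close>, so reaching everything from the identity is enough.\<close>

lemma (in group) diam_le_if_words_cover:
  assumes D: "wf_digraph D" "verts D = carrier G"
    and arc: "\<And>u z. u \<in> carrier G \<Longrightarrow> z \<in> set zs \<Longrightarrow> \<exists>a\<in>arcs D. tail D a = u \<and> head D a = u \<otimes> z"
    and zs: "set zs \<subseteq> carrier G" and cov: "words_cover G zs x"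
  shows "diam D \<le> ereal x"
proof -
  interpret D: wf_digraph D by fact
  have "D.\<mu> (\<lambda>_. 1) u v \<le> ereal x" if uv: "u \<in> carrier G" "v \<in> carrier G" for u v
  proof -
    from uv cov obtain xs where xs: "set xs \<subseteq> set zs" "real (length xs) \<le> x" "foldr (\<otimes>) xs \<one> = inv u \<otimes> v"
      unfolding words_cover_def by (meson inv_closed m_closed)
    then have "u \<otimes> foldr (\<otimes>) xs \<one> = v" using uv by (simp flip: m_assoc)
    with awalk_of_word[OF D arc zs xs(1) uv(1)] obtain p
      where p: "D.awalk u p v" "length p = length xs" by auto
    have "ereal (real (length p)) \<le> ereal x" using p(2) xs(2) by simp
    with D.min_cost_le_walk_cost[OF p(1), of "\<lambda>_. 1"] show ?thesis
      unfolding D.awalk_cost_1 by (rule order_trans)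
  qed
  then show ?thesis by (auto simp: diam_def D(2) intro!: SUP_least)
qed

lemma (in group) diam_cayley_le:
  assumes zs: "set zs \<subseteq> carrier G" and cov: "words_cover G zs x"
  shows "diam (directed_cayley_graph G zs) \<le> ereal x"
    and "diam (undirected_cayley_graph G zs) \<le> ereal x"
proof -
  show "diam (directed_cayley_graph G zs) \<le> ereal x"
  proof (rule diam_le_if_words_cover[OF wf_digraph_directed_cayley_graph _ _ zs cov])
    show "\<exists>a\<in>arcs (directed_cayley_graph G zs). tail (directed_cayley_graph G zs) a = u \<and>
        head (directed_cayley_graph G zs) a = u \<otimes> z" if "u \<in> carrier G" "z \<in> set zs" for u z
    proof -
      from that(2) obtain i where "i < length zs" "z = zs ! i" by (auto simp: in_set_conv_nth)
      with that(1) show ?thesis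
        by (intro bexI[of _ "(u, i)"]) (auto simp: directed_cayley_graph_def)
    qed
  qed (use zs is_group in \<open>auto simp: directed_cayley_graph_def\<close>)
  interpret U: sym_digraph "undirected_cayley_graph G zs"
    by (rule sym_digraph_undirected_cayley_graph[OF is_group zs])
  show "diam (undirected_cayley_graph G zs) \<le> ereal x"
  proof (rule diam_le_if_words_cover[OF U.wf_digraph_axioms _ _ zs cov])
    show "\<exists>a\<in>arcs (undirected_cayley_graph G zs). tail (undirected_cayley_graph G zs) a = u \<and>
        head (undirected_cayley_graph G zs) a = u \<otimes> z" if "u \<in> carrier G" "z \<in> set zs" for u z
    proof -
      from that(2) obtain i where "i < length zs" "z = zs ! i" by (auto simp: in_set_conv_nth)
      with that(1) show ?thesis
        by (intro bexI[of _ "((u, i), False)"]) (auto simp: undirected_cayley_graph_def)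
    qed
  qed (simp add: undirected_cayley_graph_def)
qed

section \<open>Lower bound for the diameter in elementary abelian 2-groups\<close>

lemma card_subsets_card_le: "card {A. A \<subseteq> {..<k} \<and> card A \<le> r} = binomial_ball k r"
proof -
  have "{A. A \<subseteq> {..<k} \<and> card A \<le> r} = (\<Union>i\<le>r. {A. A \<subseteq> {..<k} \<and> card A = i})" by auto
  also have "card \<dots> = (\<Sum>i\<le>r. card {A. A \<subseteq> {..<k} \<and> card A = i})"
    by (rule card_UN_disjoint) auto
  finally show ?thesis by (simp add: binomial_ball_def n_subsets)
qed

text \<open>Since generators commute and square to the identity, a walk from the identity ends at
  the product over the indices it uses an odd number of times. With at most \<open>r\<close> steps
  there are at most \<open>binomial_ball (length zs) r\<close> such index sets, too few to reach
  everything.\<close>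

lemma (in comm_group) le_diam_if_involutions:
  assumes D: "wf_digraph D" "verts D = carrier G"
    and arc: "\<And>a. a \<in> arcs D \<Longrightarrow> \<exists>i<length zs. head D a = tail D a \<otimes> zs ! i"
    and zs: "set zs \<subseteq> carrier G"
    and invol: "\<And>x. x \<in> carrier G \<Longrightarrow> x \<otimes> x = \<one>"
    and r: "binomial_ball (length zs) r < order G"
  shows "ereal (real (r + 1)) \<le> diam D"
proof (rule ccontr)
  assume "\<not> ereal (real (r + 1)) \<le> diam D"
  then have lt: "diam D < ereal (real (r + 1))" by simp
  interpret D: wf_digraph D by fact
  let ?k = "length zs"
  define Q where "Q S = finprod G (\<lambda>i. zs ! i) S" for S
  have zc: "zs ! i \<in> carrier G" if "i < ?k" for i using that zs by auto
  have Qc: "Q S \<in> carrier G" if "S \<subseteq> {..<?k}" for S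
    unfolding Q_def using that zc by (intro finprod_closed) auto
  \<comment> \<open>Each arc inserts an index into the set or removes it. An arbitrary start set
    \<open>S0\<close> makes the induction on the walk go through.\<close>
  have walk: "\<exists>S\<subseteq>{..<?k}. card S \<le> card S0 + length p \<and> v = Q S"
    if "D.awalk u p v" "S0 \<subseteq> {..<?k}" "u = Q S0" for u p v S0
    using that
  proof (induction p arbitrary: u S0)
    case Nil
    then show ?case by (auto simp: D.awalk_Nil_iff)
  next
    case (Cons a p)
    then have a: "a \<in> arcs D" "u = tail D a" "D.awalk (head D a) p v"
      by (auto simp: D.awalk_Cons_iff)
    from arc[OF a(1)] a obtain i where i: "i < ?k" "head D a = u \<otimes> zs ! i" by auto
    have finS: "finite S0" using Cons.prems finite_subset by blast
    have "\<exists>S1\<subseteq>{..<?k}. card S1 \<le> card S0 + 1 \<and> head D a = Q S1"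
    proof (cases "i \<in> S0")
      case False
      have "Q (insert i S0) = zs ! i \<otimes> Q S0"
        unfolding Q_def using False finS Cons.prems zc i by (intro finprod_insert) auto
      then show ?thesis using i Cons.prems False finS Qc zc
        by (intro exI[of _ "insert i S0"]) (auto simp: m_comm)
    next
      case True
      have "Q (insert i (S0 - {i})) = zs ! i \<otimes> Q (S0 - {i})"
        unfolding Q_def using finS Cons.prems zc i by (intro finprod_insert) auto
      moreover have "insert i (S0 - {i}) = S0" using True by auto
      moreover have Q': "Q (S0 - {i}) \<in> carrier G" using Cons.prems by (intro Qc) auto
      ultimately have "u \<otimes> zs ! i = zs ! i \<otimes> zs ! i \<otimes> Q (S0 - {i})"
        using Cons.prems zc[OF i(1)] by (simp add: m_ac)
      then have "u \<otimes> zs ! i = Q (S0 - {i})" using Q' zc[OF i(1)] invol by simp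
      then show ?thesis using i Cons.prems
        by (intro exI[of _ "S0 - {i}"]) (auto simp: card_Diff1_le le_SucI)
    qed
    then obtain S1 where S1: "S1 \<subseteq> {..<?k}" "card S1 \<le> card S0 + 1" "head D a = Q S1" by auto
    from Cons.IH[OF a(3) S1(1,3)] obtain S
      where "S \<subseteq> {..<?k}" "card S \<le> card S1 + length p" "v = Q S" by blast
    with S1(2) show ?case by (intro exI[of _ S]) simp
  qed
  have "carrier G \<subseteq> Q ` {S. S \<subseteq> {..<?k} \<and> card S \<le> r}"
  proof
    fix v assume v: "v \<in> carrier G"
    have "D.\<mu> (\<lambda>_. 1) \<one> v \<le> diam D"
      unfolding diam_def D(2) using v by (intro SUP_upper2[of \<one>] SUP_upper) auto
    with lt have "D.\<mu> (\<lambda>_. 1) \<one> v < ereal (real (r + 1))" by simp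
    \<comment> \<open>An infimum below \<open>r + 1\<close> is witnessed by a walk of cost below
      \<open>r + 1\<close>, that is, with at most \<open>r\<close> arcs.\<close>
    then obtain p where p: "D.awalk \<one> p v" "real (length p) < real (r + 1)"
      unfolding D.\<mu>_def by (auto simp: INF_less_iff D.awalk_cost_1)
    from walk[OF p(1), of "{}"] obtain S where "S \<subseteq> {..<?k}" "card S \<le> length p" "v = Q S"
      by (auto simp: Q_def)
    with p(2) show "v \<in> Q ` {S. S \<subseteq> {..<?k} \<and> card S \<le> r}" by auto
  qed
  moreover have fin: "finite {S. S \<subseteq> {..<?k} \<and> card S \<le> r}" by simp
  ultimately have "order G \<le> card {S. S \<subseteq> {..<?k} \<and> card S \<le> r}"
    unfolding order_def by (metis surj_card_le)
  with r show False by (simp add: card_subsets_card_le)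
qed

lemma Z2_power_facts:
  shows comm_group_Z2_power: "comm_group (Z2_power d)"
    and Z2_power_square: "x \<in> carrier (Z2_power d) \<Longrightarrow> x \<otimes>\<^bsub>Z2_power d\<^esub> x = \<one>\<^bsub>Z2_power d\<^esub>"
    and finite_Z2_power: "finite (carrier (Z2_power d))"
    and order_Z2_power: "order (Z2_power d) = 2 ^ d"
proof -
  have "group (Z2_power d)" by (simp add: Z2_power_def)
  then interpret group "Z2_power d" .
  show "comm_group (Z2_power d)"
    by (rule group_comm_groupI)
      (auto simp: Z2_power_def mult_integer_mod_group add.commute intro!: restrict_ext)
  show "x \<otimes>\<^bsub>Z2_power d\<^esub> x = \<one>\<^bsub>Z2_power d\<^esub>" if "x \<in> carrier (Z2_power d)"
    by (auto simp: Z2_power_def mult_integer_mod_group intro!: restrict_ext)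
  show "finite (carrier (Z2_power d))"
    by (auto simp: Z2_power_def carrier_integer_mod_group intro!: finite_PiE)
  show "order (Z2_power d) = 2 ^ d"
    by (simp add: order_def Z2_power_def carrier_integer_mod_group card_PiE)
qed

lemma le_diam_cayley_Z2_power:
  assumes zs: "set zs \<subseteq> carrier (Z2_power d)" and r: "binomial_ball (length zs) r < 2 ^ d"
  shows "ereal (real (r + 1)) \<le> diam (directed_cayley_graph (Z2_power d) zs)"
    and "ereal (real (r + 1)) \<le> diam (undirected_cayley_graph (Z2_power d) zs)"
proof -
  interpret H: comm_group "Z2_power d" by (rule comm_group_Z2_power)
  note invol = Z2_power_square[of _ d]
  note r' = r[folded order_Z2_power]
  show "ereal (real (r + 1)) \<le> diam (directed_cayley_graph (Z2_power d) zs)"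
    by (rule H.le_diam_if_involutions[OF wf_digraph_directed_cayley_graph[OF H.is_group zs] _ _ zs invol r'])
       (auto simp: directed_cayley_graph_def)
  interpret U: sym_digraph "undirected_cayley_graph (Z2_power d) zs"
    by (rule sym_digraph_undirected_cayley_graph[OF H.is_group zs])
  show "ereal (real (r + 1)) \<le> diam (undirected_cayley_graph (Z2_power d) zs)"
  proof (rule H.le_diam_if_involutions[OF U.wf_digraph_axioms _ _ zs invol r'])
    fix a assume "a \<in> arcs (undirected_cayley_graph (Z2_power d) zs)"
    then obtain g i b where a: "a = ((g, i), b)" "g \<in> carrier (Z2_power d)" "i < length zs"
      by (auto simp: undirected_cayley_graph_def)
    then have z: "zs ! i \<in> carrier (Z2_power d)" using zs by auto
    \<comment> \<open>A reversed arc also multiplies by \<open>zs ! i\<close>, because this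
      generator is its own inverse.\<close>
    then have "g \<otimes>\<^bsub>Z2_power d\<^esub> zs ! i \<otimes>\<^bsub>Z2_power d\<^esub> zs ! i = g"
      using a(2) invol[OF z] by (simp add: H.m_assoc)
    then show "\<exists>i<length zs. head (undirected_cayley_graph (Z2_power d) zs) a =
        tail (undirected_cayley_graph (Z2_power d) zs) a \<otimes>\<^bsub>Z2_power d\<^esub> zs ! i"
      using a by (intro exI[of _ i]) (auto simp: undirected_cayley_graph_def)
  qed (auto simp: undirected_cayley_graph_def)
qed

section \<open>Passage to the limit\<close>

lemma set_pmf_uniform_generators:
  assumes "group G" "finite (carrier G)"
  shows "set_pmf (uniform_generators G k) = tuples (carrier G) k"
proof -
  have "carrier G \<noteq> {}" using assms(1) by (metis group.is_monoid monoid.one_closed empty_iff)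
  with assms(2) show ?thesis
    by (auto simp: uniform_generators_def set_replicate_pmf tuples_def)
qed

text \<open>Take for \<open>F\<close> the index sets of size at most \<open>D + t\<close> among the
  first \<open>k - m\<close> generators; the last \<open>m\<close> provide the final factor. The
  failure probability is then at most the quantity sent to 0 by
  \<open>tendsto_0_failure_bound\<close>.\<close>

lemma words_cover_whp:
  fixes G :: "nat \<Rightarrow> ('a, 'b) monoid_scheme" and n k D :: "nat \<Rightarrow> nat" and c \<delta> :: real
  assumes c: "0 < c" "c \<le> 1" and \<delta>: "0 < \<delta>"
    and k: "filterlim k at_top sequentially" and D: "filterlim D at_top sequentially"
    and G: "\<And>N. group (G N)" "\<And>N. finite (carrier (G N))" "\<And>N. order (G N) = n N"
    and nk: "\<forall>\<^sub>F N in sequentially. n N \<le> 2 ^ k N"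
    and nD: "\<forall>\<^sub>F N in sequentially. n N \<le> binomial_ball (k N) (D N)"
    and Dk: "\<forall>\<^sub>F N in sequentially. real (D N) \<le> (1 / 2 - c / 8) * k N"
  shows "(\<lambda>N. measure_pmf.prob (uniform_generators (G N) (k N))
            {zs. words_cover (G N) zs ((1 + \<delta>) * D N)}) \<longlonglongrightarrow> 1"
proof -
  have npos: "n N > 0" for N
    using G[of N] by (metis group.is_monoid monoid.order_gt_0_iff_finite)
  obtain t m :: "nat \<Rightarrow> nat" and \<epsilon> :: real where \<epsilon>: "\<epsilon> > 0"
    and small: "\<forall>\<^sub>F N in sequentially. m N \<le> k N \<and> real (D N + t N + 1) \<le> (1 + \<delta>) * D N"
    and lim: "(\<lambda>N. n N / (binomial_ball (k N - m N) (D N + t N) * \<epsilon>) + n N * \<epsilon> ^ m N) \<longlonglongrightarrow> 0"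
    using tendsto_0_failure_bound[OF c \<delta> k D npos nk nD Dk] by blast
  let ?P = "\<lambda>N. measure_pmf.prob (uniform_generators (G N) (k N))"
  let ?W = "\<lambda>N. {zs. words_cover (G N) zs ((1 + \<delta>) * D N)}"
  have lower: "\<forall>\<^sub>F N in sequentially.
      1 - (n N / (binomial_ball (k N - m N) (D N + t N) * \<epsilon>) + n N * \<epsilon> ^ m N) \<le> ?P N (?W N)"
    using small
  proof eventually_elim
    case (elim N)
    interpret group "G N" by (rule G)
    define i where "i = k N - m N"
    define F where "F = {A. A \<subseteq> {..<i} \<and> card A \<le> D N + t N}"
    have ki: "i + m N = k N" using elim by (simp add: i_def)
    have cF: "card F = binomial_ball i (D N + t N)" unfolding F_def by (rule card_subsets_card_le)
    define B where "B = {zs. \<not> (\<forall>v\<in>carrier (G N). \<exists>A\<in>F. \<exists>w\<in>set (drop i zs).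
       v = subproduct (G N) A (take i zs) \<otimes>\<^bsub>G N\<^esub> w)}"
    have F: "F \<subseteq> Pow {..<i}" "F \<noteq> {}" by (auto simp: F_def)
    have "?P N B \<le> n N / (card F * \<epsilon>) + n N * \<epsilon> ^ m N"
      using prob_not_covered_le[OF G(2) F \<epsilon>, of "m N"] unfolding ki B_def G(3) .
    moreover have "1 - ?P N B = ?P N (- B)"
      using measure_pmf.prob_compl[of B "uniform_generators (G N) (k N)"]
      by (simp add: Compl_eq_Diff_UNIV)
    \<comment> \<open>The inclusion is proved on the support only, where the generators lie in the
      group.\<close>
    moreover have "?P N (- B) \<le> ?P N (?W N)"
    proof (rule measure_pmf.finite_measure_mono_AE)
      show "AE zs in measure_pmf (uniform_generators (G N) (k N)). zs \<in> - B \<longrightarrow> zs \<in> ?W N"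
        unfolding AE_measure_pmf_iff
      proof (intro ballI impI)
        fix zs assume "zs \<in> set_pmf (uniform_generators (G N) (k N))" and B: "zs \<in> - B"
        then have zs: "set zs \<subseteq> carrier (G N)"
          by (simp add: set_pmf_uniform_generators G tuples_def)
        have "words_cover (G N) zs (real (D N + t N + 1))"
        proof (rule words_cover_if_subproducts[OF zs, of F _ i])
          show "finite A \<and> card A \<le> D N + t N" if "A \<in> F" for A
            using that by (auto simp: F_def dest: finite_subset)
          show "\<forall>v\<in>carrier (G N). \<exists>A\<in>F. \<exists>w\<in>set (drop i zs).
              v = subproduct (G N) A (take i zs) \<otimes>\<^bsub>G N\<^esub> w"
            using B by (simp add: B_def)
        qed
        with elim show "zs \<in> ?W N" by (auto intro: words_cover_mono)
      qed
    qed simp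
    ultimately show ?case by (simp add: cF i_def)
  qed
  have upper: "\<forall>\<^sub>F N in sequentially. ?P N (?W N) \<le> 1" by simp
  have "(\<lambda>N. 1 - (n N / (binomial_ball (k N - m N) (D N + t N) * \<epsilon>) + n N * \<epsilon> ^ m N)) \<longlonglongrightarrow> 1"
    using tendsto_diff[OF tendsto_const lim, of 1] by simp
  from tendsto_sandwich[OF lower upper this tendsto_const] show ?thesis .
qed

lemma tendsto_1_prob_superset:
  assumes lim: "(\<lambda>N. measure_pmf.prob (p N) (A N)) \<longlonglongrightarrow> 1"
    and sub: "\<forall>\<^sub>F N in sequentially. \<forall>x\<in>set_pmf (p N). x \<in> A N \<longrightarrow> x \<in> B N"
  shows "(\<lambda>N. measure_pmf.prob (p N) (B N)) \<longlonglongrightarrow> 1"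
proof -
  have lower: "\<forall>\<^sub>F N in sequentially. measure_pmf.prob (p N) (A N) \<le> measure_pmf.prob (p N) (B N)"
    using sub by eventually_elim
      (auto intro!: measure_pmf.finite_measure_mono_AE simp: AE_measure_pmf_iff)
  have upper: "\<forall>\<^sub>F N in sequentially. measure_pmf.prob (p N) (B N) \<le> 1" by simp
  from tendsto_sandwich[OF lower upper lim tendsto_const] show ?thesis .
qed

text \<open>From \<open>n \<le> Suc k ^ D\<close> it follows that \<open>D\<close> is at least
  \<open>ln n / (2 * ln k)\<close>, which tends to infinity. The 2 comes from
  \<open>Suc k \<le> k ^ 2\<close>, valid once \<open>k\<close> is at least 2.\<close>

lemma filterlim_binomial_ball_radius:
  fixes n k D :: "nat \<Rightarrow> nat"
  assumes n: "filterlim n at_top sequentially"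
    and lim: "(\<lambda>N. ln (real (k N)) / ln (real (n N))) \<longlonglongrightarrow> 0"
    and k: "filterlim k at_top sequentially"
    and nD: "\<forall>\<^sub>F N in sequentially. n N \<le> binomial_ball (k N) (D N)"
  shows "filterlim D at_top sequentially"
proof -
  have ev: "\<forall>\<^sub>F N in sequentially. 2 \<le> n N \<and> 2 \<le> k N"
    using n k by (simp add: filterlim_at_top eventually_conj_iff)
  have inv: "filterlim (\<lambda>N. inverse (ln (real (k N)) / ln (real (n N)))) at_top sequentially"
  proof (rule filterlim_inverse_at_top[OF lim])
    show "\<forall>\<^sub>F N in sequentially. 0 < ln (real (k N)) / ln (real (n N))"
      using ev by eventually_elim simp
  qed
  have "filterlim (\<lambda>N. 1 / 2 * inverse (ln (real (k N)) / ln (real (n N)))) at_top sequentially"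
    by (rule filterlim_tendsto_pos_mult_at_top[OF tendsto_const _ inv]) simp
  moreover have "\<forall>\<^sub>F N in sequentially. 1 / 2 * inverse (ln (real (k N)) / ln (real (n N))) \<le> real (D N)"
    using ev nD
  proof eventually_elim
    case (elim N)
    have "n N \<le> Suc (k N) ^ D N" using elim binomial_ball_le_power order_trans by blast
    also have "Suc (k N) ^ D N \<le> (k N ^ 2) ^ D N"
    proof (rule power_mono)
      have "Suc (k N) \<le> 2 * k N" using elim by simp
      also have "\<dots> \<le> k N * k N" using elim by (intro mult_right_mono) auto
      finally show "Suc (k N) \<le> k N ^ 2" by (simp add: power2_eq_square)
    qed simp
    finally have "real (n N) \<le> real (k N) ^ (2 * D N)"
      by (metis of_nat_le_iff of_nat_power power_mult)
    then have "ln (real (n N)) \<le> ln (real (k N) ^ (2 * D N))"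
      using elim by (subst ln_le_cancel_iff) auto
    also have "\<dots> = 2 * D N * ln (real (k N))" using elim by (simp add: ln_realpow)
    finally show ?case using elim by (simp add: field_simps)
  qed
  ultimately have "filterlim (\<lambda>N. real (D N)) at_top sequentially"
    by (rule filterlim_at_top_mono)
  then show ?thesis by (simp add: filterlim_sequentially_iff_filterlim_real)
qed

theorem corollary4:
  fixes d n k :: "nat \<Rightarrow> nat"
    and G :: "nat \<Rightarrow> ('a, 'b) monoid_scheme"
    and H :: "nat \<Rightarrow> (nat \<Rightarrow> int) monoid"
  defines "H \<equiv> \<lambda>N. Z2_power (d N)"
  assumes "\<And>N. d N > 0" and "filterlim d at_top sequentially"
    and "\<And>N. n N > 0" and "filterlim n at_top sequentially"
    and "\<And>N. n N \<le> 2 ^ d N"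
    and "\<And>N. group (G N)" and "\<And>N. finite (carrier (G N))" and "\<And>N. order (G N) = n N"
    and "\<And>N. k N > 0"
    and "liminf (\<lambda>N. ereal ((real (k N) - log 2 (real (n N))) / real (k N))) > 0"
    and "(\<lambda>N. ln (real (k N)) / ln (real (n N))) \<longlonglongrightarrow> 0"
  shows "le_up_to_smaller_order_whp
           (\<lambda>N. uniform_generators (G N) (k N)) (\<lambda>N Z. diam (directed_cayley_graph (G N) Z))
           (\<lambda>N. uniform_generators (H N) (k N)) (\<lambda>N Z. diam (directed_cayley_graph (H N) Z))
       \<and> le_up_to_smaller_order_whp
           (\<lambda>N. uniform_generators (G N) (k N)) (\<lambda>N Z. diam (undirected_cayley_graph (G N) Z))
           (\<lambda>N. uniform_generators (H N) (k N)) (\<lambda>N Z. diam (undirected_cayley_graph (H N) Z))"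
proof -
  note npos = assms(4) and n_lim = assms(5) and nd = assms(6) and G = assms(7-9) and kpos = assms(10)
  obtain c :: real where c: "0 < c" "c \<le> 1"
    and n_le: "\<forall>\<^sub>F N in sequentially. real (n N) \<le> 2 powr ((1 - c) * k N)"
  proof -
    obtain b where b: "0 < ereal b" "ereal b < liminf (\<lambda>N. ereal ((real (k N) - log 2 (real (n N))) / real (k N)))"
      using ereal_dense2[OF assms(11)] by auto
    \<comment> \<open>Any positive constant below the limit inferior works; the cap at 1 keeps the
      exponent \<open>(1 - c) * k\<close> nonnegative.\<close>
    define c where "c = min b 1"
    show thesis
    proof (rule that[of c])
      show "0 < c" "c \<le> 1" using b by (auto simp: c_def)
      from less_LiminfD[OF b(2)]
      show "\<forall>\<^sub>F N in sequentially. real (n N) \<le> 2 powr ((1 - c) * k N)"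
      proof eventually_elim
        case (elim N)
        then have "b * k N < k N - log 2 (n N)" using kpos[of N] by (simp add: field_simps)
        moreover have "c * k N \<le> b * k N" unfolding c_def by (intro mult_right_mono) auto
        ultimately have "log 2 (n N) \<le> (1 - c) * k N" by (simp add: algebra_simps)
        then show ?case using npos[of N] by (simp add: log_le_iff)
      qed
    qed
  qed
  have nk: "\<forall>\<^sub>F N in sequentially. n N \<le> 2 ^ k N"
    using n_le
  proof eventually_elim
    case (elim N)
    have "(2::real) powr ((1 - c) * k N) \<le> 2 powr k N"
      using c by (intro powr_mono) (auto simp: algebra_simps)
    with elim have "real (n N) \<le> 2 powr k N" by (rule order_trans)
    then show ?case by (simp add: powr_realpow)
  qed
  have k_lim: "filterlim k at_top sequentially"
    unfolding filterlim_at_top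
  proof
    fix j :: nat
    have "\<forall>\<^sub>F N in sequentially. 2 ^ j \<le> n N"
      using n_lim by (simp add: filterlim_at_top)
    with nk show "\<forall>\<^sub>F N in sequentially. j \<le> k N"
    proof eventually_elim
      case (elim N)
      then have "(2::nat) ^ j \<le> 2 ^ k N" by (meson order_trans)
      then show ?case by simp
    qed
  qed
  \<comment> \<open>For finitely many \<open>N\<close> there may be no such \<open>r\<close>, so
    attainment is shown only eventually; minimality holds for every \<open>N\<close>.\<close>
  define D where "D N = (LEAST r. n N \<le> binomial_ball (k N) r)" for N
  have D_less: "binomial_ball (k N) r < n N" if "r < D N" for N r
    using not_less_Least[of r "\<lambda>r. n N \<le> binomial_ball (k N) r"] that by (simp add: D_def)
  have "\<forall>\<^sub>F N in sequentially. \<exists>r. r \<le> (1 / 2 - c / 8) * k N \<and> 2 powr ((1 - c) * k N) \<le> binomial_ball (k N) r"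
    by (rule eventually_compose_filterlim[OF eventually_le_binomial_ball[OF c] k_lim])
  with n_le have D: "\<forall>\<^sub>F N in sequentially. n N \<le> binomial_ball (k N) (D N) \<and> real (D N) \<le> (1 / 2 - c / 8) * k N"
  proof eventually_elim
    case (elim N)
    then obtain r where r: "r \<le> (1 / 2 - c / 8) * k N" "2 powr ((1 - c) * k N) \<le> binomial_ball (k N) r"
      by blast
    then have nr: "n N \<le> binomial_ball (k N) r" using elim by simp
    then have "n N \<le> binomial_ball (k N) (D N)" unfolding D_def by (rule LeastI)
    moreover have "D N \<le> r" unfolding D_def using nr by (rule Least_le)
    ultimately show ?case using r by simp
  qed
  have nD: "\<forall>\<^sub>F N in sequentially. n N \<le> binomial_ball (k N) (D N)"
    and Dk: "\<forall>\<^sub>F N in sequentially. real (D N) \<le> (1 / 2 - c / 8) * k N"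
    using D by (auto elim: eventually_mono)
  have D_lim: "filterlim D at_top sequentially"
    by (rule filterlim_binomial_ball_radius[OF n_lim assms(12) k_lim nD])
  obtain \<delta> :: "nat \<Rightarrow> real" where \<delta>: "\<delta> \<longlonglongrightarrow> 0" "\<And>N. \<delta> N > 0"
    and whp: "(\<lambda>N. measure_pmf.prob (uniform_generators (G N) (k N))
      {zs. words_cover (G N) zs ((1 + \<delta> N) * D N)}) \<longlonglongrightarrow> 1"
    by (rule diagonal_tendsto_1[where p = "\<lambda>N \<delta>. measure_pmf.prob (uniform_generators (G N) (k N))
        {zs. words_cover (G N) zs ((1 + \<delta>) * D N)}"])
       (use words_cover_whp[OF c _ k_lim D_lim G nk nD Dk] in auto)
  have G_le: "diam (directed_cayley_graph (G N) Z) \<le> ereal x"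
      "diam (undirected_cayley_graph (G N) Z) \<le> ereal x"
    if "Z \<in> set_pmf (uniform_generators (G N) (k N))" "words_cover (G N) Z x" for N Z x
    using that group.diam_cayley_le[OF G(1)[of N]]
    by (simp_all add: set_pmf_uniform_generators G tuples_def)
  have upper_directed: "(\<lambda>N. measure_pmf.prob (uniform_generators (G N) (k N))
        {Z. diam (directed_cayley_graph (G N) Z) \<le> ereal ((1 + \<delta> N) * D N)}) \<longlonglongrightarrow> 1"
    by (rule tendsto_1_prob_superset[OF whp], rule always_eventually) (use G_le(1) in blast)
  have upper_undirected: "(\<lambda>N. measure_pmf.prob (uniform_generators (G N) (k N))
        {Z. diam (undirected_cayley_graph (G N) Z) \<le> ereal ((1 + \<delta> N) * D N)}) \<longlonglongrightarrow> 1"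
    by (rule tendsto_1_prob_superset[OF whp], rule always_eventually) (use G_le(2) in blast)
  have H_le: "\<forall>\<^sub>F N in sequentially. \<forall>Z\<in>set_pmf (uniform_generators (H N) (k N)).
      ereal ((1 - \<delta> N) * D N) \<le> diam (directed_cayley_graph (H N) Z) \<and>
      ereal ((1 - \<delta> N) * D N) \<le> diam (undirected_cayley_graph (H N) Z)"
    using eventually_compose_filterlim[OF eventually_gt_at_top[of 0] D_lim]
  proof (eventually_elim, intro ballI)
    fix N Z assume pos: "0 < D N" and "Z \<in> set_pmf (uniform_generators (H N) (k N))"
    then have Z: "set Z \<subseteq> carrier (Z2_power (d N))" "length Z = k N"
      using set_pmf_uniform_generators[OF comm_group.axioms(2)[OF comm_group_Z2_power] finite_Z2_power]
      by (auto simp: H_def tuples_def)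
    \<comment> \<open>By minimality the ball of radius \<open>D - 1\<close> has fewer than
      \<open>n \<le> 2 ^ d\<close> points. The resulting lower bound \<open>D\<close> holds for
      every choice of generators; \<open>D > 0\<close> makes the subtraction genuine.\<close>
    have "binomial_ball (length Z) (D N - 1) < 2 ^ d N"
      using D_less[of "D N - 1" N] nd[of N] pos Z(2) by simp
    from le_diam_cayley_Z2_power[OF Z(1) this]
    have "ereal (real (D N)) \<le> diam (directed_cayley_graph (H N) Z)"
      "ereal (real (D N)) \<le> diam (undirected_cayley_graph (H N) Z)"
      using pos by (simp_all add: H_def)
    moreover have "ereal ((1 - \<delta> N) * D N) \<le> ereal (real (D N))"
      using \<delta>(2)[of N] by (simp add: algebra_simps)
    ultimately show "ereal ((1 - \<delta> N) * D N) \<le> diam (directed_cayley_graph (H N) Z) \<and>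
        ereal ((1 - \<delta> N) * D N) \<le> diam (undirected_cayley_graph (H N) Z)"
      by (meson order_trans)
  qed
  have one: "(\<lambda>N. measure_pmf.prob (uniform_generators (H N) (k N)) UNIV) \<longlonglongrightarrow> 1" by simp
  have lower_directed: "(\<lambda>N. measure_pmf.prob (uniform_generators (H N) (k N))
        {Z. ereal ((1 - \<delta> N) * D N) \<le> diam (directed_cayley_graph (H N) Z)}) \<longlonglongrightarrow> 1"
    by (rule tendsto_1_prob_superset[OF one], rule eventually_mono[OF H_le]) blast
  have lower_undirected: "(\<lambda>N. measure_pmf.prob (uniform_generators (H N) (k N))
        {Z. ereal ((1 - \<delta> N) * D N) \<le> diam (undirected_cayley_graph (H N) Z)}) \<longlonglongrightarrow> 1"
    by (rule tendsto_1_prob_superset[OF one], rule eventually_mono[OF H_le]) blast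
  show ?thesis
    unfolding le_up_to_smaller_order_whp_def
    by (intro conjI exI[of _ "\<lambda>N. real (D N)"] exI[of _ \<delta>] \<delta>(1)
        upper_directed upper_undirected lower_directed lower_undirected)
qed

end
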